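(* Let $\bar X$ be a toric Fano manifold, with $LX=X\times N$, $\Phi_q\in C^\infty(LX)$, the mirror Landau–Ginzburg model $(Y,W)$, and the SYZ mirror transformation $\mathcal F$ and inverse SYZ mirror transformation $\mathcal F^{-1}$ as defined in the context. Then $$\mathcal F(\Phi_q)=e^W,\qquad \mathcal F^{-1}(e^W)=\Phi_q,$$ and, with $\omega_X=\omega_{\bar X}|_X$ and $\Omega_Y$ the holomorphic volume form on $Y$, $$\mathcal F(\Phi_q\,e^{\sqrt{-1}\omega_X})=e^W\Omega_Y,\qquad \mathcal F^{-1}(e^W\Omega_Y)=\Phi_q\,e^{\sqrt{-1}\omega_X}.$$
   Context: Toric setting. $N\cong\mathbb{Z}^n$, $M=\mathrm{Hom}(N,\mathbb{Z})$, $M_\mathbb{R}=M\otimes\mathbb{R}$, pairing $\langle\cdot,\cdot\rangle$. $\bar X$ is a smooth projective toric variety of complex dimension $n$ with ample anticanonical bundle; $v_1,\dots,v_d\in N$ are the primitive generators of the 1-dimensional cones of its fan $\Sigma$, $l=d-n$; $v_1=e_1,\dots,v_n=e_n$ is assumed to be the standard basis of $N$. Coordinates $q=(q_1,\dots,q_l)$, $q_a>0$, on the Kähler cone correspond to the polytope $\bar P=\{x\in M_\mathbb{R}:\langle x,v_i\rangle\ge\lambda_i\ \forall i\}$ with $\lambda_1=\dots=\lambda_n=0$, $\lambda_{n+a}=\log q_a$; it has normal fan $\Sigma$ and determines a Kähler form $\omega_{\bar X}$. $P$ is the interior of $\bar P$, $X\subset\bar X$ the open dense torus orbit, $\mu:X\to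 P$ the moment map, $L_x=\mu^{-1}(x)$. One has $X=P\times T_N$, $T_N=\mathbb{R}^n/(2\pi\mathbb{Z})^n$, with coordinates $x_j$ on $P$, $u_j$ on $T_N$ and $\omega_X=\sum_j dx_j\wedge du_j$. $LX=X\times N$ carries the pulled back symplectic form, still denoted $\omega_X$; $\mu:LX\to P$ denotes also the composite $LX\to X\to P$. Mirror. $Y=P\times T_M$, $T_M=\mathbb{R}^n/(2\pi\mathbb{Z})^n$ with coordinates $y_j$ dual to $u_j$, projection $\nu:Y\to P$, complex coordinates $z_j=\exp(-x_j-\sqrt{-1}y_j)$; thus $Y=\{z\in(\mathbb{C}^* )^n:|e^{\lambda_i}z^{v_i}|<1,\ i=1,\dots,d\}$, where $z^v=z_1^{v^1}\cdots z_n^{v^n}$. $\Omega_Y=\bigwedge_{j=1}^n(-dx_j-\sqrt{-1}dy_j)=\frac{dz_1}{z_1}\wedge\dots\wedge\frac{dz_n}{z_n}$, and $W=\sum_{i=1}^de^{\lambda_i}z^{v_i}$. The function $\Phi_q$. For $x\in P$, $\pi_2(\bar X,L_x)\cong\mathbb{Z}^d$ is freely generated by the Maslov index two holomorphic disc classes $\beta_1,\dots,\beta_d$, with $\partial\beta_i=v_i\in N=\pi_1(L_x)$ and $\int_{\beta_i}\omega_{\bar X}=2\pi(\langle x,v_i\rangle-\lambda_i)$ (Cho–Oh). For $(p,v)\in LX$, $x=\mu(p)$, $$\Phi_q(p,v)=\sum_{\beta=\sum k_i\beta_i,\ k_i\in\mathbb{Z}_{\ge0},\ \partial\beta=v}\frac1{k_1!\cdots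 k_d!}e^{-\frac1{2\pi}\int_\beta\omega_{\bar X}}.$$ Transformations. On $LX\times_PY=P\times N\times T_N\times T_M$ with projections $\pi_{LX},\pi_Y$, let $F=\sqrt{-1}\sum_jdy_j\wedge du_j$ and $\mathrm{hol}(p,v,z)=e^{-\sqrt{-1}\langle y,v\rangle}$. Then $$\mathcal F(\alpha)=(-2\pi\sqrt{-1})^{-n}\int_{N\times T_N}\pi_{LX}^*(\alpha)\wedge e^{\sqrt{-1}F}\,\mathrm{hol}\quad(\alpha\in\Omega^*(LX)),$$ $$\mathcal F^{-1}(\alpha)=(-2\pi\sqrt{-1})^{-n}\int_{T_M}\pi_Y^*(\alpha)\wedge e^{-\sqrt{-1}F}\,\mathrm{hol}^{-1}\quad(\alpha\in\Omega^*(Y)),$$ where $\int_{N\times T_N}$ means summation over $N$ and fibre integration over $T_N$. Orientations: $\int_{T_N}\bigwedge_{j}(\theta_j\wedge du_j)=(2\pi)^n\theta_1\wedge\dots\wedge\theta_n$ for 1-forms $\theta_j$ pulled back from $Y$, and $\int_{T_M}\beta\wedge dy_1\wedge\dots\wedge dy_n=(2\pi)^n\beta$ for forms $\beta$ pulled back from $LX$. On functions: a $T_N$-invariant $f:LX\to\mathbb{C}$ is admissible if $f(p,v)=f_ve^{-\langle x,v\rangle}$ with constants $f_v\in\mathbb{C}$ and $\sum_{v\in N}f_vz^v$ converges to an analytic function on $Y$; then $\mathcal F(f):=\sum_vf_vz^v$. For $\phi$ holomorphic on $Y$, $\mathcal F^{-1}(\phi)$ is the function on $LX$ of fibrewise Fourier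 coefficients, $\mathcal F^{-1}(\phi)(p,v)=(2\pi)^{-n}\int_{T_M}\phi(x,y)e^{\sqrt{-1}\langle y,v\rangle}dy_1\cdots dy_n$, $x=\mu(p)$. The claim that $\mathcal F(\Phi_q)=e^W$ includes that $\Phi_q$ is admissible. *)

theory Defs
  imports "HOL-Analysis.Analysis"
begin

text \<open>
  The lattice \<open>N\<close> is \<open>int^'n\<close> and \<open>M\<^sub>\<real>\<close> is \<open>real^'n\<close>; the pairing of \<open>x \<in> M\<^sub>\<real>\<close> with \<open>w \<in> N\<close> is
  \<open>x \<bullet> of_N w\<close>.  The index type \<open>'n\<close> is finite and linearly ordered, that is, it is
  \<open>{1, \<dots>, n}\<close> up to renaming; the order is needed for ordered wedge products.
  The rays of the fan are indexed by an arbitrary finite type \<open>'i\<close> in the general toric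
  definitions, and by \<open>'n + 'l\<close> (with \<open>l = d - n\<close>) from the polytope of \<open>q\<close> on.
\<close>

definition of_N :: "int^'n \<Rightarrow> real^'n" where
  "of_N w = (\<chi> j. real_of_int (w $ j))"


section \<open>Smooth projective toric varieties through their fans\<close>

definition is_fan :: "(real^'n) set set \<Rightarrow> bool" where
  "is_fan S \<longleftrightarrow> finite S \<and> S \<noteq> {} \<and>
     (\<forall>\<sigma>\<in>S. (\<exists>A :: (int^'n) set. finite A \<and> \<sigma> = convex_cone hull (of_N ` A)) \<and>
            \<sigma> \<inter> uminus ` \<sigma> = {0}) \<and>
     (\<forall>\<sigma>\<in>S. \<forall>\<tau>. \<tau> face_of \<sigma> \<and> \<tau> \<noteq> {} \<longrightarrow> \<tau> \<in> S) \<and>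
     (\<forall>\<sigma>\<in>S. \<forall>\<tau>\<in>S. \<sigma> \<inter> \<tau> face_of \<sigma> \<and> \<sigma> \<inter> \<tau> face_of \<tau>)"

definition is_lattice_basis :: "('n \<Rightarrow> int^'n) \<Rightarrow> bool" where
  "is_lattice_basis B \<longleftrightarrow> (\<forall>w. \<exists>!c :: 'n \<Rightarrow> int. w = (\<Sum>j\<in>UNIV. c j *s B j))"

definition smooth_fan :: "(real^'n) set set \<Rightarrow> bool" where
  "smooth_fan S \<longleftrightarrow>
     (\<forall>\<sigma>\<in>S. \<exists>B J. is_lattice_basis B \<and> \<sigma> = convex_cone hull ((\<lambda>j. of_N (B j)) ` J))"

definition primitive_vector :: "int^'n \<Rightarrow> bool" where
  "primitive_vector w \<longleftrightarrow> w \<noteq> 0 \<and> (\<forall>k u. w = k *s u \<longrightarrow> \<bar>k\<bar> = 1)"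

definition primitive_ray_generators :: "(real^'n) set set \<Rightarrow> ('i \<Rightarrow> int^'n) \<Rightarrow> bool" where
  "primitive_ray_generators S v \<longleftrightarrow> (\<forall>i. primitive_vector (v i)) \<and>
     bij_betw (\<lambda>i. convex_cone hull {of_N (v i)}) UNIV {\<rho>\<in>S. aff_dim \<rho> = 1}"

definition polyhedron_of :: "('i \<Rightarrow> int^'n) \<Rightarrow> ('i \<Rightarrow> real) \<Rightarrow> (real^'n) set" where
  "polyhedron_of v lam = {x. \<forall>i. x \<bullet> of_N (v i) \<ge> lam i}"

text \<open>Inner normals: \<open>normal_cone P F\<close> consists of the functionals that attain their minimum
  over \<open>P\<close> along all of \<open>F\<close>.\<close>

definition normal_cone :: "(real^'n) set \<Rightarrow> (real^'n) set \<Rightarrow> (real^'n) set" where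
  "normal_cone P F = {u. \<forall>x\<in>F. \<forall>y\<in>P. x \<bullet> u \<le> y \<bullet> u}"

definition normal_fan :: "(real^'n) set \<Rightarrow> (real^'n) set set" where
  "normal_fan P = normal_cone P ` {F. F face_of P \<and> F \<noteq> {}}"

text \<open>The torus-invariant divisor \<open>D = \<Sum>\<^sub>i a\<^sub>i D\<^sub>i\<close> has the polytope
  \<open>{m. \<langle>m, v\<^sub>i\<rangle> \<ge> - a\<^sub>i}\<close>.  On a complete smooth toric variety, \<open>D\<close> is ample iff the
  normal fan of this polytope is the fan of the variety.\<close>

definition ample_divisor :: "(real^'n) set set \<Rightarrow> ('i \<Rightarrow> int^'n) \<Rightarrow> ('i \<Rightarrow> int) \<Rightarrow> bool" where
  "ample_divisor S v a \<longleftrightarrow> normal_fan (polyhedron_of v (\<lambda>i. - real_of_int (a i))) = S"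

text \<open>The anticanonical divisor is \<open>\<Sum>\<^sub>i D\<^sub>i\<close>.\<close>

definition toric_fano :: "(real^'n) set set \<Rightarrow> ('i \<Rightarrow> int^'n) \<Rightarrow> bool" where
  "toric_fano S v \<longleftrightarrow> is_fan S \<and> \<Union>S = UNIV \<and> smooth_fan S \<and> primitive_ray_generators S v \<and>
     (\<exists>a. ample_divisor S v a) \<and> ample_divisor S v (\<lambda>i. 1)"


section \<open>The symplectic side and the mirror\<close>

definition lambda_of :: "real^'l \<Rightarrow> 'n + 'l \<Rightarrow> real" where
  "lambda_of q i = (case i of Inl j \<Rightarrow> 0 | Inr a \<Rightarrow> ln (q $ a))"

definition Pbar :: "('n + 'l \<Rightarrow> int^'n) \<Rightarrow> real^'l \<Rightarrow> (real^'n) set" where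
  "Pbar v q = polyhedron_of v (lambda_of q)"

definition Pint :: "('n + 'l \<Rightarrow> int^'n) \<Rightarrow> real^'l \<Rightarrow> (real^'n) set" where
  "Pint v q = interior (Pbar v q)"

text \<open>Both tori \<open>\<real>\<^sup>n/(2\<pi>\<int>)\<^sup>n\<close> are embedded in \<open>\<complex>\<^sup>n\<close>: a point of \<open>T\<^sub>N\<close> is \<open>(e\<^sup>i\<^sup>u\<^sub>j)\<^sub>j\<close>.  A point of
  \<open>LX = P \<times> T\<^sub>N \<times> N\<close> is written \<open>((x, t), w)\<close>.\<close>

definition torus_point :: "real^'n \<Rightarrow> complex^'n" where
  "torus_point u = (\<chi> j. cis (u $ j))"

type_synonym 'n LX_point = "((real^'n) \<times> (complex^'n)) \<times> (int^'n)"

definition torus_orbit :: "('n + 'l \<Rightarrow> int^'n) \<Rightarrow> real^'l \<Rightarrow> ((real^'n) \<times> (complex^'n)) set" where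
  "torus_orbit v q = Pint v q \<times> range torus_point"

definition LX :: "('n + 'l \<Rightarrow> int^'n) \<Rightarrow> real^'l \<Rightarrow> 'n LX_point set" where
  "LX v q = torus_orbit v q \<times> UNIV"

definition moment_map :: "'n LX_point \<Rightarrow> real^'n" where
  "moment_map \<xi> = fst (fst \<xi>)"

text \<open>Points of \<open>Y = P \<times> T\<^sub>M\<close> are given by their complex coordinates
  \<open>z\<^sub>j = exp (- x\<^sub>j - i y\<^sub>j)\<close>.  The angle \<open>y\<^sub>j\<close> is determined modulo \<open>2\<pi>\<close>; \<open>y_coord\<close> picks a
  representative.\<close>

definition Y_point :: "real^'n \<Rightarrow> real^'n \<Rightarrow> complex^'n" where
  "Y_point x y = (\<chi> j. exp (- of_real (x $ j) - \<i> * of_real (y $ j)))"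

definition mirror_Y :: "('n + 'l \<Rightarrow> int^'n) \<Rightarrow> real^'l \<Rightarrow> (complex^'n) set" where
  "mirror_Y v q = {Y_point x y | x y. x \<in> Pint v q}"

definition nu_proj :: "complex^'n \<Rightarrow> real^'n" where
  "nu_proj z = (\<chi> j. - ln (cmod (z $ j)))"

definition y_coord :: "complex^'n \<Rightarrow> real^'n" where
  "y_coord z = (\<chi> j. - Arg (z $ j))"

definition zpow :: "complex^'n \<Rightarrow> int^'n \<Rightarrow> complex" where
  "zpow z w = (\<Prod>j\<in>UNIV. (z $ j) powi (w $ j))"

definition superpotential :: "('n + 'l \<Rightarrow> int^'n) \<Rightarrow> real^'l \<Rightarrow> complex^'n \<Rightarrow> complex" where
  "superpotential v q z = (\<Sum>i\<in>UNIV. of_real (exp (lambda_of q i)) * zpow z (v i))"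


lemma of_N_eq_0_iff [simp]: "of_N w = 0 \<longleftrightarrow> w = 0"
  by (simp add: of_N_def vec_eq_iff)

lemma Pint_eq:
  assumes "\<And>i. v i \<noteq> 0"
  shows "Pint v q = {x. \<forall>i. x \<bullet> of_N (v i) > lambda_of q i}"
proof -
  have "Pbar v q = (\<Inter>i. {x. of_N (v i) \<bullet> x \<ge> lambda_of q i})"
    by (auto simp: Pbar_def polyhedron_of_def inner_commute)
  moreover have "interior (\<Inter>i\<in>I. A i) = (\<Inter>i\<in>I. interior (A i))"
    if "finite I" for I and A :: "'a + 'b \<Rightarrow> (real^'a) set"
    using that by (induction I) auto
  moreover have "interior {x. of_N (v i) \<bullet> x \<ge> lambda_of q i} = {x. of_N (v i) \<bullet> x > lambda_of q i}" for i
    using assms[of i] by (intro interior_halfspace_ge) simp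
  ultimately have "Pint v q = (\<Inter>i. {x. of_N (v i) \<bullet> x > lambda_of q i})"
    by (simp only: Pint_def finite)
  then show ?thesis
    by (auto simp: inner_commute)
qed

lemma cmod_zpow:
  assumes "\<And>j. z $ j \<noteq> 0"
  shows "cmod (zpow z w) = exp (- (nu_proj z \<bullet> of_N w))"
proof -
  have "cmod (zpow z w) = (\<Prod>j\<in>UNIV. cmod (z $ j) powi (w $ j))"
    by (simp add: zpow_def prod_norm[symmetric] norm_power_int)
  also have "\<dots> = (\<Prod>j\<in>UNIV. exp (ln (cmod (z $ j)) * of_int (w $ j)))"
  proof (intro prod.cong refl)
    fix j
    have "cmod (z $ j) powi (w $ j) = exp (ln (cmod (z $ j))) powi (w $ j)"
      using assms[of j] by simp
    then show "cmod (z $ j) powi (w $ j) = exp (ln (cmod (z $ j)) * of_int (w $ j))"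
      by (simp only: exp_power_int mult.commute)
  qed
  also have "\<dots> = exp (- (nu_proj z \<bullet> of_N w))"
    by (simp add: exp_sum nu_proj_def inner_vec_def of_N_def sum_negf)
  finally show ?thesis .
qed

lemma mirror_Y_eq:
  assumes "\<And>i. v i \<noteq> 0"
  shows "mirror_Y v q = {z. (\<forall>j. z $ j \<noteq> 0) \<and>
    (\<forall>i. cmod (of_real (exp (lambda_of q i)) * zpow z (v i)) < 1)}"
proof -
  have nu: "nu_proj (Y_point x y) = x" for x y :: "real^'a"
    by (simp add: nu_proj_def Y_point_def vec_eq_iff)
  have nz: "Y_point x y $ j \<noteq> 0" for x y :: "real^'a" and j
    by (simp add: Y_point_def)
  have inv: "Y_point (nu_proj z) (y_coord z) = z" if "\<forall>j. z $ j \<noteq> 0" for z :: "complex^'a"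
  proof -
    have "exp (of_real (ln (cmod (z $ j))) + \<i> * of_real (Arg (z $ j))) = z $ j" for j
      using that Arg_eq[of "z $ j"] by (simp add: exp_add exp_of_real)
    then show ?thesis
      by (simp add: Y_point_def nu_proj_def y_coord_def vec_eq_iff)
  qed
  have "mirror_Y v q = {z. (\<forall>j. z $ j \<noteq> 0) \<and> nu_proj z \<in> Pint v q}"
    unfolding mirror_Y_def using nu nz inv by (auto, metis)
  moreover have "cmod (of_real (exp (lambda_of q i)) * zpow z (v i)) < 1 \<longleftrightarrow>
      nu_proj z \<bullet> of_N (v i) > lambda_of q i" if "\<forall>j. z $ j \<noteq> 0" for z i
    using that by (simp add: norm_mult cmod_zpow flip: exp_add)
  ultimately show ?thesis
    using assms by (auto simp: Pint_eq)
qed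


section \<open>The function Phi\<close>

text \<open>A class \<open>\<beta> = \<Sum>\<^sub>i k\<^sub>i \<beta>\<^sub>i\<close> in the free abelian group \<open>\<pi>\<^sub>2(Xbar, L\<^sub>x)\<close> is given by its
  coefficients \<open>k\<close>.  Its boundary and its symplectic area are given by the Cho--Oh formulas
  on the generators.\<close>

definition disc_boundary :: "('n + 'l \<Rightarrow> int^'n) \<Rightarrow> ('n + 'l \<Rightarrow> int) \<Rightarrow> int^'n" where
  "disc_boundary v k = (\<Sum>i\<in>UNIV. k i *s v i)"

definition disc_area ::
  "('n + 'l \<Rightarrow> int^'n) \<Rightarrow> real^'l \<Rightarrow> real^'n \<Rightarrow> ('n + 'l \<Rightarrow> int) \<Rightarrow> real" where
  "disc_area v q x k =
     (\<Sum>i\<in>UNIV. of_int (k i) * (2 * pi * (x \<bullet> of_N (v i) - lambda_of q i)))"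

definition Phi_term ::
  "('n + 'l \<Rightarrow> int^'n) \<Rightarrow> real^'l \<Rightarrow> 'n LX_point \<Rightarrow> ('n + 'l \<Rightarrow> nat) \<Rightarrow> real" where
  "Phi_term v q \<xi> k =
     1 / (\<Prod>i\<in>UNIV. fact (k i)) * exp (- (1 / (2 * pi)) * disc_area v q (moment_map \<xi>) (\<lambda>i. int (k i)))"

definition Phi_classes ::
  "('n + 'l \<Rightarrow> int^'n) \<Rightarrow> 'n LX_point \<Rightarrow> ('n + 'l \<Rightarrow> nat) set" where
  "Phi_classes v \<xi> = {k. disc_boundary v (\<lambda>i. int (k i)) = snd \<xi>}"

definition Phi :: "('n + 'l \<Rightarrow> int^'n) \<Rightarrow> real^'l \<Rightarrow> 'n LX_point \<Rightarrow> complex" where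
  "Phi v q \<xi> = of_real (\<Sum>\<^sub>\<infinity>k\<in>Phi_classes v \<xi>. Phi_term v q \<xi> k)"


section \<open>The transformations on functions\<close>

definition holomorphic_on_Cn :: "(complex^'n \<Rightarrow> complex) \<Rightarrow> (complex^'n) set \<Rightarrow> bool" where
  "holomorphic_on_Cn f U \<longleftrightarrow>
     (\<forall>z\<in>U. \<exists>D. (f has_derivative D) (at z) \<and> (\<forall>c h. D (c *s h) = c * D h))"

definition is_fibre_coeffs ::
  "('n + 'l \<Rightarrow> int^'n) \<Rightarrow> real^'l \<Rightarrow> ('n LX_point \<Rightarrow> complex) \<Rightarrow> (int^'n \<Rightarrow> complex) \<Rightarrow> bool" where
  "is_fibre_coeffs v q f c \<longleftrightarrow>
     (\<forall>p\<in>torus_orbit v q. \<forall>w. f (p, w) = c w * of_real (exp (- (moment_map (p, w) \<bullet> of_N w))))"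

definition admissible ::
  "('n + 'l \<Rightarrow> int^'n) \<Rightarrow> real^'l \<Rightarrow> ('n LX_point \<Rightarrow> complex) \<Rightarrow> bool" where
  "admissible v q f \<longleftrightarrow> (\<exists>c. is_fibre_coeffs v q f c \<and>
     (\<forall>z\<in>mirror_Y v q. (\<lambda>w. c w * zpow z w) summable_on UNIV) \<and>
     holomorphic_on_Cn (\<lambda>z. \<Sum>\<^sub>\<infinity>w. c w * zpow z w) (mirror_Y v q))"

text \<open>The coefficients of an admissible function are unique as soon as \<open>P\<close> is nonempty.\<close>

definition SYZ_fun ::
  "('n + 'l \<Rightarrow> int^'n) \<Rightarrow> real^'l \<Rightarrow> ('n LX_point \<Rightarrow> complex) \<Rightarrow> complex^'n \<Rightarrow> complex" where
  "SYZ_fun v q f z = (\<Sum>\<^sub>\<infinity>w. (THE c. is_fibre_coeffs v q f c) w * zpow z w)"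

definition angle_box :: "(real^'n) set" where
  "angle_box = cbox 0 (\<chi> j. 2 * pi)"

definition SYZ_inv_fun :: "(complex^'n \<Rightarrow> complex) \<Rightarrow> 'n LX_point \<Rightarrow> complex" where
  "SYZ_inv_fun \<phi> \<xi> = 1 / (2 * of_real pi) ^ CARD('n) *
     integral angle_box (\<lambda>y. \<phi> (Y_point (moment_map \<xi>) y) * exp (\<i> * of_real (y \<bullet> of_N (snd \<xi>))))"


section \<open>Differential forms\<close>

text \<open>\<open>DX j\<close>, \<open>DY j\<close>, \<open>DU j\<close> name the 1-forms \<open>dx\<^sub>j\<close>, \<open>dy\<^sub>j\<close>, \<open>du\<^sub>j\<close>, which are a global
  coframe of the fibre product \<open>LX \<times>\<^sub>P Y = P \<times> N \<times> T\<^sub>N \<times> T\<^sub>M\<close>.\<close>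

datatype 'n coframe = DX 'n | DY 'n | DU 'n

lemma coframe_UNIV: "(UNIV :: 'n coframe set) = range DX \<union> range DY \<union> range DU"
proof -
  have "c \<in> range DX \<union> range DY \<union> range DU" for c :: "'n coframe"
    by (cases c) auto
  then show ?thesis by blast
qed

instance coframe :: (finite) finite
  by standard (simp add: coframe_UNIV)

text \<open>The order \<open>DX < DY < DU\<close> only fixes which signed monomials serve as the basis of the
  exterior algebra.\<close>

instantiation coframe :: (linorder) linorder
begin

definition less_eq_coframe :: "'a coframe \<Rightarrow> 'a coframe \<Rightarrow> bool" where
  "less_eq_coframe a b = (case a of
     DX i \<Rightarrow> (case b of DX j \<Rightarrow> i \<le> j | _ \<Rightarrow> True)
   | DY i \<Rightarrow> (case b of DX j \<Rightarrow> False | DY j \<Rightarrow> i \<le> j | DU j \<Rightarrow> True)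
   | DU i \<Rightarrow> (case b of DU j \<Rightarrow> i \<le> j | _ \<Rightarrow> False))"

definition less_coframe :: "'a coframe \<Rightarrow> 'a coframe \<Rightarrow> bool" where
  "less_coframe a b \<longleftrightarrow> a \<le> b \<and> \<not> b \<le> a"

instance
proof
  fix a b c :: "'a coframe"
  show "a < b \<longleftrightarrow> a \<le> b \<and> \<not> b \<le> a"
    by (fact less_coframe_def)
  show "a \<le> a"
    by (cases a) (simp_all add: less_eq_coframe_def)
  show "a \<le> b \<Longrightarrow> b \<le> c \<Longrightarrow> a \<le> c"
    by (cases a; cases b; cases c) (simp_all add: less_eq_coframe_def)
  show "a \<le> b \<Longrightarrow> b \<le> a \<Longrightarrow> a = b"
    by (cases a; cases b) (simp_all add: less_eq_coframe_def)
  show "a \<le> b \<or> b \<le> a"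
    by (cases a; cases b) (auto simp: less_eq_coframe_def)
qed

end

text \<open>An element of the complexified exterior algebra is given by its coordinates with respect
  to the monomials \<open>e\<^sub>I = g\<^sub>1 \<and> \<dots> \<and> g\<^sub>k\<close>, where \<open>I = {g\<^sub>1 < \<dots> < g\<^sub>k}\<close>.
  A form on \<open>LX\<close> is a function from points of \<open>LX\<close> to elements without \<open>DY\<close> components, a form
  on \<open>Y\<close> a function from points of \<open>Y\<close> to elements without \<open>DU\<close> components.  As the three
  spaces use the same names for their coframes, pulling back along a projection is just
  composition with it.\<close>

type_synonym 'n ext = "complex ^ ('n coframe set)"

definition ext_gen :: "'n::{finite,linorder} coframe \<Rightarrow> 'n ext" where
  "ext_gen g = axis {g} 1"

definition ext_one :: "'n::{finite,linorder} ext" where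
  "ext_one = axis {} 1"

text \<open>\<open>e\<^sub>I \<and> e\<^sub>J = wedge_sign I J e\<^sub>I\<^sub>\<union>\<^sub>J\<close> for disjoint \<open>I\<close>, \<open>J\<close>.\<close>

definition wedge_sign :: "'g::linorder set \<Rightarrow> 'g set \<Rightarrow> complex" where
  "wedge_sign I J = (-1) ^ card {(i, j). i \<in> I \<and> j \<in> J \<and> j < i}"

definition wedge :: "'n::{finite,linorder} ext \<Rightarrow> 'n ext \<Rightarrow> 'n ext" (infixr "\<and>\<^sub>E" 70) where
  "a \<and>\<^sub>E b = (\<chi> K. \<Sum>I\<in>Pow K. wedge_sign I (K - I) * (a $ I) * (b $ (K - I)))"

definition wedge_power :: "'n::{finite,linorder} ext \<Rightarrow> nat \<Rightarrow> 'n ext" where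
  "wedge_power a m = ((\<lambda>b. a \<and>\<^sub>E b) ^^ m) ext_one"

definition ext_exp :: "'n::{finite,linorder} ext \<Rightarrow> 'n ext" where
  "ext_exp a = (\<Sum>m. (1 / fact m) *s wedge_power a m)"

definition ordered_wedge :: "('n::{finite,linorder} \<Rightarrow> 'n ext) \<Rightarrow> 'n ext" where
  "ordered_wedge \<theta> = foldr (\<lambda>j b. \<theta> j \<and>\<^sub>E b) (sorted_list_of_set UNIV) ext_one"

definition omega_X :: "'n::{finite,linorder} ext" where
  "omega_X = (\<Sum>j\<in>UNIV. ext_gen (DX j) \<and>\<^sub>E ext_gen (DU j))"

definition Omega_Y :: "'n::{finite,linorder} ext" where
  "Omega_Y = ordered_wedge (\<lambda>j. - ext_gen (DX j) - \<i> *s ext_gen (DY j))"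

definition curv_F :: "'n::{finite,linorder} ext" where
  "curv_F = \<i> *s (\<Sum>j\<in>UNIV. ext_gen (DY j) \<and>\<^sub>E ext_gen (DU j))"

definition hol :: "'n LX_point \<Rightarrow> complex^'n \<Rightarrow> complex" where
  "hol \<xi> z = exp (- \<i> * of_real (y_coord z \<bullet> of_N (snd \<xi>)))"

text \<open>\<open>top_coeff G a\<close> is the \<open>b\<close> free of \<open>G\<close> such that \<open>a - b \<and> e\<^sub>G\<close> only involves monomials
  that do not contain all of \<open>G\<close>.\<close>

definition top_coeff :: "'n::{finite,linorder} coframe set \<Rightarrow> 'n ext \<Rightarrow> 'n ext" where
  "top_coeff G a = (\<chi> A. if A \<inter> G = {} then wedge_sign A G * (a $ (A \<union> G)) else 0)"

text \<open>Fibre integrals of a form given along the fibre by the angles.  For \<open>T\<^sub>M\<close> the convention is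
  \<open>\<integral> b \<and> dy\<^sub>1 \<and> \<dots> \<and> dy\<^sub>n = (2\<pi>)\<^sup>n b\<close>.  For \<open>T\<^sub>N\<close> it is
  \<open>\<integral> (\<theta>\<^sub>1 \<and> du\<^sub>1) \<and> \<dots> \<and> (\<theta>\<^sub>n \<and> du\<^sub>n) = (2\<pi>)\<^sup>n \<theta>\<^sub>1 \<and> \<dots> \<and> \<theta>\<^sub>n\<close>, where reordering the left hand
  side into \<open>(\<theta>\<^sub>1 \<and> \<dots> \<and> \<theta>\<^sub>n) \<and> (du\<^sub>1 \<and> \<dots> \<and> du\<^sub>n)\<close> produces the sign \<open>(-1)\<^sup>n\<^sup>(\<^sup>n\<^sup>-\<^sup>1\<^sup>)\<^sup>/\<^sup>2\<close>.\<close>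

definition TN_integral :: "((real, 'n::{finite,linorder}) vec \<Rightarrow> 'n ext) \<Rightarrow> 'n ext" where
  "TN_integral g =
     (-1) ^ (CARD('n) * (CARD('n) - 1) div 2) *s top_coeff (range DU) (integral angle_box g)"

definition TM_integral :: "((real, 'n::{finite,linorder}) vec \<Rightarrow> 'n ext) \<Rightarrow> 'n ext" where
  "TM_integral g = top_coeff (range DY) (integral angle_box g)"


section \<open>The transformations on forms\<close>

definition SYZ_integrand ::
  "('n::{finite,linorder} LX_point \<Rightarrow> 'n ext) \<Rightarrow> 'n LX_point \<Rightarrow> (complex, 'n) vec \<Rightarrow> 'n ext" where
  "SYZ_integrand \<alpha> \<xi> z = hol \<xi> z *s (\<alpha> \<xi> \<and>\<^sub>E ext_exp (\<i> *s curv_F))"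

definition SYZ_inv_integrand ::
  "((complex, 'n) vec \<Rightarrow> 'n::{finite,linorder} ext) \<Rightarrow> 'n LX_point \<Rightarrow> (complex, 'n) vec \<Rightarrow> 'n ext" where
  "SYZ_inv_integrand \<alpha> \<xi> z = inverse (hol \<xi> z) *s (\<alpha> z \<and>\<^sub>E ext_exp (- (\<i> *s curv_F)))"

definition SYZ ::
  "('n::{finite,linorder} LX_point \<Rightarrow> 'n ext) \<Rightarrow> (complex, 'n) vec \<Rightarrow> 'n ext" where
  "SYZ \<alpha> z = (1 / (- 2 * of_real pi * \<i>) ^ CARD('n)) *s
     (\<Sum>\<^sub>\<infinity>w. TN_integral (\<lambda>u. SYZ_integrand \<alpha> ((nu_proj z, torus_point u), w) z))"

definition SYZ_inv ::
  "((complex, 'n) vec \<Rightarrow> 'n::{finite,linorder} ext) \<Rightarrow> 'n LX_point \<Rightarrow> 'n ext" where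
  "SYZ_inv \<alpha> \<xi> = (1 / (- 2 * of_real pi * \<i>) ^ CARD('n)) *s
     TM_integral (\<lambda>y. SYZ_inv_integrand \<alpha> \<xi> (Y_point (moment_map \<xi>) y))"

text \<open>\<open>infsum\<close> and \<open>integral\<close> have the value 0 where they do not converge, hence the following
  predicates.\<close>

definition SYZ_converges ::
  "('n::{finite,linorder} + 'l \<Rightarrow> (int, 'n) vec) \<Rightarrow> real^'l \<Rightarrow> ('n LX_point \<Rightarrow> 'n ext) \<Rightarrow> bool" where
  "SYZ_converges v q \<alpha> \<longleftrightarrow> (\<forall>z\<in>mirror_Y v q.
     (\<forall>w. (\<lambda>u. SYZ_integrand \<alpha> ((nu_proj z, torus_point u), w) z) integrable_on angle_box) \<and>
     (\<lambda>w. TN_integral (\<lambda>u. SYZ_integrand \<alpha> ((nu_proj z, torus_point u), w) z)) summable_on UNIV)"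

definition SYZ_inv_converges ::
  "('n::{finite,linorder} + 'l \<Rightarrow> (int, 'n) vec) \<Rightarrow> real^'l \<Rightarrow> ((complex, 'n) vec \<Rightarrow> 'n ext) \<Rightarrow> bool" where
  "SYZ_inv_converges v q \<alpha> \<longleftrightarrow> (\<forall>\<xi>\<in>LX v q.
     (\<lambda>y. SYZ_inv_integrand \<alpha> \<xi> (Y_point (moment_map \<xi>) y)) integrable_on angle_box)"

end

theory Submission
  imports Defs
begin

text \<open>
  Expanding each factor of \<open>e\<^sup>W = \<Prod>\<^sub>i exp (e\<^sup>\<lambda>\<^sup>i z\<^sup>v\<^sup>i)\<close> gives an absolutely convergent series over
  \<open>k \<in> \<nat>\<^sup>d\<close> on all of \<open>(\<complex>\<^sup>*)\<^sup>n\<close>; grouping the terms by \<open>\<partial>\<beta> = \<Sum>\<^sub>i k\<^sub>i v\<^sub>i\<close> turns it into the Laurent series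
  whose coefficients are those of \<open>\<Phi>\<^sub>q\<close>, and these are recovered by Fourier orthogonality.
  On forms, with \<open>\<theta>\<^sub>j = - dx\<^sub>j - \<i> dy\<^sub>j\<close>, everything factors over \<open>j\<close>:
  \<open>e\<^sup>\<i>\<^sup>\<omega> \<and> e\<^sup>\<i>\<^sup>F = \<Prod>\<^sub>j (1 - \<i> \<theta>\<^sub>j \<and> du\<^sub>j)\<close> and
  \<open>\<Omega>\<^sub>Y \<and> e\<^sup>-\<^sup>\<i>\<^sup>F = \<Prod>\<^sub>j (- dx\<^sub>j - \<i> (1 + \<i> dx\<^sub>j \<and> du\<^sub>j) \<and> dy\<^sub>j)\<close>,
  so that the fibre integrals are read off factor by factor.
\<close>

section \<open>Exterior algebra\<close>

lemma wedge_nth: "(a \<and>\<^sub>E b) $ K = (\<Sum>I\<in>Pow K. wedge_sign I (K - I) * (a $ I) * (b $ (K - I)))"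
  by (simp add: wedge_def)

lemma wedge_add_left: "(a + b) \<and>\<^sub>E c = a \<and>\<^sub>E c + b \<and>\<^sub>E c"
  by (simp add: vec_eq_iff wedge_nth algebra_simps sum.distrib)

lemma wedge_add_right: "a \<and>\<^sub>E (b + c) = a \<and>\<^sub>E b + a \<and>\<^sub>E c"
  by (simp add: vec_eq_iff wedge_nth algebra_simps sum.distrib)

lemma wedge_scale_left: "(k *s a) \<and>\<^sub>E b = k *s (a \<and>\<^sub>E b)"
  by (simp add: vec_eq_iff wedge_nth sum_distrib_left mult_ac)

lemma wedge_scale_right: "a \<and>\<^sub>E (k *s b) = k *s (a \<and>\<^sub>E b)"
  by (simp add: vec_eq_iff wedge_nth sum_distrib_left mult_ac)

lemma wedge_zero_left [simp]: "0 \<and>\<^sub>E b = 0"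
  by (simp add: vec_eq_iff wedge_nth)

lemma wedge_zero_right [simp]: "a \<and>\<^sub>E 0 = 0"
  by (simp add: vec_eq_iff wedge_nth)

lemma wedge_minus_left: "(- a) \<and>\<^sub>E b = - (a \<and>\<^sub>E b)"
  by (simp add: vec_eq_iff wedge_nth sum_negf)

lemma wedge_minus_right: "a \<and>\<^sub>E (- b) = - (a \<and>\<^sub>E b)"
  by (simp add: vec_eq_iff wedge_nth sum_negf)

lemma wedge_diff_left: "(a - b) \<and>\<^sub>E c = a \<and>\<^sub>E c - b \<and>\<^sub>E c"
  using wedge_add_left[of a "-b" c] by (simp add: wedge_minus_left)

lemma wedge_diff_right: "a \<and>\<^sub>E (b - c) = a \<and>\<^sub>E b - a \<and>\<^sub>E c"
  using wedge_add_right[of a b "-c"] by (simp add: wedge_minus_right)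

lemmas wedge_linear = wedge_add_left wedge_add_right wedge_scale_left wedge_scale_right
  wedge_minus_left wedge_minus_right wedge_diff_left wedge_diff_right

lemma scaleR_eq_smult: "r *\<^sub>R a = complex_of_real r *s a"
  for a :: "complex ^ 'm"
  by (simp add: vec_eq_iff scaleR_conv_of_real[where 'a = complex])

text \<open>In finite dimension linearity gives boundedness; this lets a wedge factor pass through
  the infinite sum in the exponential series.\<close>

lemma bounded_linear_wedge_right: "bounded_linear (\<lambda>b. a \<and>\<^sub>E b)"
  unfolding linear_conv_bounded_linear[symmetric]
proof (rule linearI)
  show "a \<and>\<^sub>E (b + c) = a \<and>\<^sub>E b + a \<and>\<^sub>E c" for b c
    by (rule wedge_add_right)
  show "a \<and>\<^sub>E (r *\<^sub>R b) = r *\<^sub>R (a \<and>\<^sub>E b)" for r b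
    by (simp add: scaleR_eq_smult wedge_scale_right)
qed

text \<open>The exponent of the sign counts inversions, and the inversions of a disjoint union split
  into two disjoint sets.\<close>

lemma wedge_sign_Un_left:
  fixes I J K :: "'g::{finite,linorder} set"
  assumes "I \<inter> J = {}"
  shows "wedge_sign (I \<union> J) K = wedge_sign I K * wedge_sign J K"
proof -
  have "{(i, j). i \<in> I \<union> J \<and> j \<in> K \<and> j < i} =
      {(i, j). i \<in> I \<and> j \<in> K \<and> j < i} \<union> {(i, j). i \<in> J \<and> j \<in> K \<and> j < i}" by auto
  moreover have "card \<dots> = card {(i, j). i \<in> I \<and> j \<in> K \<and> j < i} + card {(i, j). i \<in> J \<and> j \<in> K \<and> j < i}"
    using assms by (intro card_Un_disjoint) auto
  ultimately show ?thesis by (simp add: wedge_sign_def power_add)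
qed

lemma wedge_sign_Un_right:
  fixes I J K :: "'g::{finite,linorder} set"
  assumes "J \<inter> K = {}"
  shows "wedge_sign I (J \<union> K) = wedge_sign I J * wedge_sign I K"
proof -
  have "{(i, j). i \<in> I \<and> j \<in> J \<union> K \<and> j < i} =
      {(i, j). i \<in> I \<and> j \<in> J \<and> j < i} \<union> {(i, j). i \<in> I \<and> j \<in> K \<and> j < i}" by auto
  moreover have "card \<dots> = card {(i, j). i \<in> I \<and> j \<in> J \<and> j < i} + card {(i, j). i \<in> I \<and> j \<in> K \<and> j < i}"
    using assms by (intro card_Un_disjoint) auto
  ultimately show ?thesis by (simp add: wedge_sign_def power_add)
qed

lemma wedge_sign_empty [simp]: "wedge_sign {} J = 1" "wedge_sign I {} = 1"
  by (simp_all add: wedge_sign_def)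

lemma wedge_sign_square [simp]: "wedge_sign I J * wedge_sign I J = 1"
  by (simp add: wedge_sign_def flip: power_add)

text \<open>Both sides sum over ordered splittings of \<open>L\<close> into three blocks, and both
  signs are the product of the three signs of pairs of blocks.\<close>

lemma wedge_assoc: "(a \<and>\<^sub>E b) \<and>\<^sub>E c = a \<and>\<^sub>E (b \<and>\<^sub>E c)"
proof -
  have "((a \<and>\<^sub>E b) \<and>\<^sub>E c) $ L = (a \<and>\<^sub>E (b \<and>\<^sub>E c)) $ L" for L
  proof -
    have "((a \<and>\<^sub>E b) \<and>\<^sub>E c) $ L = (\<Sum>K\<in>Pow L. \<Sum>I\<in>Pow K.
        wedge_sign K (L - K) * (wedge_sign I (K - I) * (a $ I) * (b $ (K - I))) * c $ (L - K))"
      by (simp add: wedge_nth sum_distrib_left sum_distrib_right)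
    also have "\<dots> = (\<Sum>(K, I)\<in>Sigma (Pow L) Pow.
        wedge_sign K (L - K) * (wedge_sign I (K - I) * (a $ I) * (b $ (K - I))) * c $ (L - K))"
      by (rule sum.Sigma) auto
    also have "\<dots> = (\<Sum>(I, J)\<in>Sigma (Pow L) (\<lambda>I. Pow (L - I)).
        wedge_sign I (L - I) * a $ I * (wedge_sign J (L - I - J) * b $ J * c $ (L - I - J)))"
    \<comment> \<open>A chain I \<subseteq> K \<subseteq> L corresponds to its first two blocks
      \<open>I\<close> and \<open>J = K - I\<close>. Only the equality of the summands, goal 5,
      needs the sign rules.\<close>
    proof (rule sum.reindex_bij_witness[where i = "\<lambda>(I, J). (I \<union> J, I)" and j = "\<lambda>(K, I). (I, K - I)"],
        goal_cases)
      case (5 p)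
      obtain K I where p: "p = (K, I)" by (cases p)
      with 5 have KI: "I \<subseteq> K" "K \<subseteq> L" by auto
      have "K = I \<union> (K - I)" "L - I = (K - I) \<union> (L - K)" "L - I - (K - I) = L - K"
        using KI by auto
      then have "wedge_sign K (L - K) = wedge_sign I (L - K) * wedge_sign (K - I) (L - K)"
        "wedge_sign I (L - I) = wedge_sign I (K - I) * wedge_sign I (L - K)"
        by (metis Diff_disjoint wedge_sign_Un_left)
          (metis Diff_disjoint Int_commute \<open>L - I - (K - I) = L - K\<close> \<open>L - I = (K - I) \<union> (L - K)\<close> wedge_sign_Un_right)
      then show ?case
        by (simp add: p \<open>L - I - (K - I) = L - K\<close> mult_ac)
    qed auto
    also have "\<dots> = (\<Sum>I\<in>Pow L. \<Sum>J\<in>Pow (L - I).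
        wedge_sign I (L - I) * a $ I * (wedge_sign J (L - I - J) * b $ J * c $ (L - I - J)))"
      by (rule sum.Sigma[symmetric]) auto
    also have "\<dots> = (a \<and>\<^sub>E (b \<and>\<^sub>E c)) $ L"
      by (simp add: wedge_nth sum_distrib_left)
    finally show ?thesis .
  qed
  then show ?thesis by (simp add: vec_eq_iff)
qed

text \<open>Only the component at \<open>G\<close> of the right factor is nonzero, so a single
  splitting of \<open>K\<close> survives, the one with \<open>G\<close> last.\<close>

lemma wedge_axis_right_nth:
  "(a \<and>\<^sub>E axis G k) $ K = (if G \<subseteq> K then wedge_sign (K - G) G * a $ (K - G) * k else 0)"
proof (cases "G \<subseteq> K")
  case True
  have "(a \<and>\<^sub>E axis G k) $ K = (\<Sum>I\<in>{K - G}. wedge_sign I (K - I) * a $ I * axis G k $ (K - I))"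
    unfolding wedge_nth by (rule sum.mono_neutral_right) (use True in \<open>auto simp: axis_def\<close>)
  also have "\<dots> = wedge_sign (K - G) G * a $ (K - G) * k"
    using True by (simp add: double_diff axis_def)
  finally show ?thesis using True by simp
next
  case False
  then have "K - I \<noteq> G" for I by auto
  then show ?thesis using False by (simp add: wedge_nth axis_def)
qed

lemma wedge_axis_axis:
  "axis I k \<and>\<^sub>E axis J m = (if I \<inter> J = {} then axis (I \<union> J) (wedge_sign I J * k * m) else 0)"
  unfolding vec_eq_iff
proof
  fix K
  show "(axis I k \<and>\<^sub>E axis J m) $ K =
      (if I \<inter> J = {} then axis (I \<union> J) (wedge_sign I J * k * m) else 0) $ K"
    unfolding wedge_axis_right_nth
    by (auto simp: axis_def Un_Diff Diff_triv intro!: arg_cong2[of _ _ _ _ wedge_sign])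
qed

lemma wedge_one_right [simp]: "a \<and>\<^sub>E ext_one = a"
  by (simp add: vec_eq_iff ext_one_def wedge_axis_right_nth)

lemma wedge_one_left [simp]: "ext_one \<and>\<^sub>E a = a"
proof -
  have "(ext_one \<and>\<^sub>E a) $ K = a $ K" for K
  proof -
    have "(ext_one \<and>\<^sub>E a) $ K = (\<Sum>I\<in>{{}}. wedge_sign I (K - I) * ext_one $ I * a $ (K - I))"
      unfolding wedge_nth by (rule sum.mono_neutral_right) (auto simp: ext_one_def axis_def)
    then show ?thesis by (simp add: ext_one_def)
  qed
  then show ?thesis by (simp add: vec_eq_iff)
qed

lemma ext_gen_square [simp]: "ext_gen g \<and>\<^sub>E ext_gen g = 0"
  by (simp add: ext_gen_def wedge_axis_axis)

lemma wedge_sign_singletons: "wedge_sign {g} {h} = (if h < g then - 1 else 1)"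
proof -
  have "{(i, j). i \<in> {g} \<and> j \<in> {h} \<and> j < i} = (if h < g then {(g, h)} else {})" by auto
  then show ?thesis by (simp add: wedge_sign_def)
qed

lemma ext_gen_anticommute: "ext_gen g \<and>\<^sub>E ext_gen h = - (ext_gen h \<and>\<^sub>E ext_gen g)"
proof -
  have "axis I (- x) = - axis I x" for I :: "'a coframe set" and x :: complex
    by (simp add: vec_eq_iff axis_def)
  then show ?thesis
    by (cases g h rule: linorder_cases)
      (auto simp: ext_gen_def wedge_axis_axis wedge_sign_singletons insert_commute)
qed

section \<open>Wedge products along a list\<close>

definition wedge_list :: "('j \<Rightarrow> 'n::{finite,linorder} ext) \<Rightarrow> 'j list \<Rightarrow> 'n ext" where
  "wedge_list f js = foldr (\<lambda>j b. f j \<and>\<^sub>E b) js ext_one"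

lemma wedge_list_simps [simp]:
  "wedge_list f [] = ext_one"
  "wedge_list f (j # js) = f j \<and>\<^sub>E wedge_list f js"
  by (simp_all add: wedge_list_def)

lemma wedge_list_scale: "wedge_list (\<lambda>j. c *s f j) js = c ^ length js *s wedge_list f js"
  by (induction js) (simp_all add: wedge_linear vector_smult_assoc)

lemma wedge_list_commute:
  assumes "\<And>j. j \<in> set js \<Longrightarrow> a \<and>\<^sub>E f j = f j \<and>\<^sub>E a"
  shows "a \<and>\<^sub>E wedge_list f js = wedge_list f js \<and>\<^sub>E a"
  using assms
proof (induction js)
  case (Cons j js)
  have "a \<and>\<^sub>E (f j \<and>\<^sub>E wedge_list f js) = f j \<and>\<^sub>E (a \<and>\<^sub>E wedge_list f js)"
    using Cons.prems by (simp flip: wedge_assoc)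
  then show ?case
    using Cons by (simp add: wedge_assoc)
qed simp

lemma wedge_list_anticommute:
  assumes "\<And>j. j \<in> set js \<Longrightarrow> a \<and>\<^sub>E f j = - (f j \<and>\<^sub>E a)"
  shows "a \<and>\<^sub>E wedge_list f js = (-1) ^ length js *s (wedge_list f js \<and>\<^sub>E a)"
  using assms
proof (induction js)
  case (Cons j js)
  have "a \<and>\<^sub>E (f j \<and>\<^sub>E wedge_list f js) = - (f j \<and>\<^sub>E (a \<and>\<^sub>E wedge_list f js))"
    using Cons.prems by (simp add: wedge_minus_left flip: wedge_assoc)
  then show ?case
    using Cons by (simp add: wedge_assoc wedge_linear)
qed simp

text \<open>Each \<open>g j\<close> is moved to the left past the later factors \<open>f\<close>, at
  no cost in sign.\<close>

lemma wedge_list_mult: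
  assumes "\<And>i j. i \<in> set js \<Longrightarrow> j \<in> set js \<Longrightarrow> g i \<and>\<^sub>E f j = f j \<and>\<^sub>E g i"
  shows "wedge_list f js \<and>\<^sub>E wedge_list g js = wedge_list (\<lambda>j. f j \<and>\<^sub>E g j) js"
  using assms
proof (induction js)
  case (Cons j js)
  have "wedge_list f (j # js) \<and>\<^sub>E wedge_list g (j # js)
      = f j \<and>\<^sub>E ((wedge_list f js \<and>\<^sub>E g j) \<and>\<^sub>E wedge_list g js)"
    by (simp add: wedge_assoc)
  also have "wedge_list f js \<and>\<^sub>E g j = g j \<and>\<^sub>E wedge_list f js"
    using Cons.prems by (intro wedge_list_commute[symmetric]) auto
  also have "f j \<and>\<^sub>E ((g j \<and>\<^sub>E wedge_list f js) \<and>\<^sub>E wedge_list g js)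
      = (f j \<and>\<^sub>E g j) \<and>\<^sub>E (wedge_list f js \<and>\<^sub>E wedge_list g js)"
    by (simp add: wedge_assoc)
  finally show ?case using Cons by simp
qed simp

text \<open>Gathering the \<open>f j\<close> in front takes one transposition for each pair of
  positions, hence n(n-1)/2 sign changes. This is the sign built into
  \<open>TN_integral\<close>.\<close>

lemma wedge_list_mult_anticommute:
  assumes "\<And>i j. i \<in> set js \<Longrightarrow> j \<in> set js \<Longrightarrow> g i \<and>\<^sub>E f j = - (f j \<and>\<^sub>E g i)"
  shows "wedge_list (\<lambda>j. f j \<and>\<^sub>E g j) js =
    (-1) ^ (length js * (length js - 1) div 2) *s (wedge_list f js \<and>\<^sub>E wedge_list g js)"
  using assms
proof (induction js)
  case (Cons j js)
  let ?n = "length js" and ?F = "wedge_list f js" and ?G = "wedge_list g js"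
  have "g j \<and>\<^sub>E ?F = (-1) ^ ?n *s (?F \<and>\<^sub>E g j)"
    using Cons.prems by (intro wedge_list_anticommute) auto
  then have swap: "g j \<and>\<^sub>E (?F \<and>\<^sub>E ?G) = (-1) ^ ?n *s (?F \<and>\<^sub>E (g j \<and>\<^sub>E ?G))"
    by (metis wedge_assoc wedge_scale_left)
  \<comment> \<open>The case split is there because \<open>- 1\<close> is truncated subtraction when
    the list is empty.\<close>
  have triangle: "length (j # js) * (length (j # js) - 1) div 2 = ?n * (?n - 1) div 2 + ?n"
    by (cases ?n) (simp_all add: algebra_simps)
  have IH: "wedge_list (\<lambda>j. f j \<and>\<^sub>E g j) js = (-1) ^ (?n * (?n - 1) div 2) *s (?F \<and>\<^sub>E ?G)"
    using Cons.prems by (intro Cons.IH) auto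
  show ?case
    unfolding triangle power_add
    by (simp add: IH swap wedge_assoc wedge_scale_right vector_smult_assoc)
qed simp

text \<open>Generators listed in increasing order create no inversions, so every sign in the product
  is +1.\<close>

lemma wedge_list_gens:
  fixes d :: "'n::{finite,linorder} \<Rightarrow> 'n coframe"
  assumes "strict_mono d" "sorted js" "distinct js"
  shows "wedge_list (\<lambda>j. ext_gen (d j)) js = axis (d ` set js) 1"
  using assms(2,3)
proof (induction js)
  case (Cons j js)
  have less: "d j < d i" if "i \<in> set js" for i
    using Cons.prems that assms(1) by (auto simp: strict_mono_def order.strict_iff_order)
  then have "{(a, b). a \<in> {d j} \<and> b \<in> d ` set js \<and> b < a} = {}"
    by (auto dest: less_asym)
  then have "wedge_sign {d j} (d ` set js) = 1" 
    unfolding wedge_sign_def by (simp only: card.empty power_0)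
  moreover have "{d j} \<inter> d ` set js = {}" using less by (metis Int_insert_left Int_empty_left imageE less_irrefl)
  ultimately show ?case
    using Cons by (simp add: ext_gen_def wedge_axis_axis)
qed (simp add: ext_one_def)

section \<open>Exponentials of sums of commuting square-zero forms\<close>

lemma wedge_power_Suc: "wedge_power a (Suc m) = a \<and>\<^sub>E wedge_power a m"
  by (simp add: wedge_power_def)

lemma wedge_power_0 [simp]: "wedge_power a 0 = ext_one"
  by (simp add: wedge_power_def)

text \<open>The binomial theorem for commuting \<open>a\<close> and \<open>c\<close>, cut off after
  the term linear in \<open>c\<close> because \<open>c\<close> squares to zero.\<close>

lemma wedge_power_add_square_zero:
  assumes ac: "a \<and>\<^sub>E c = c \<and>\<^sub>E a" and cc: "c \<and>\<^sub>E c = 0"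
  shows "wedge_power (c + a) (Suc m) =
    wedge_power a (Suc m) + of_nat (Suc m) *s (c \<and>\<^sub>E wedge_power a m)"
proof (induction m)
  case 0
  then show ?case by (simp add: wedge_power_Suc)
next
  case (Suc m)
  have "c \<and>\<^sub>E (c \<and>\<^sub>E x) = 0" for x by (simp add: cc flip: wedge_assoc)
  moreover have "a \<and>\<^sub>E (c \<and>\<^sub>E x) = c \<and>\<^sub>E (a \<and>\<^sub>E x)" for x by (simp add: ac flip: wedge_assoc)
  ultimately show ?case
    unfolding wedge_power_Suc[of "c + a" "Suc m"] Suc
    by (simp add: wedge_linear wedge_power_Suc vec_eq_iff algebra_simps)
qed

text \<open>This is exp (c + a) = (1 + c) exp a. It is phrased with \<open>sums\<close>, so that
  convergence is carried along with the value.\<close>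

lemma ext_exp_sums_add:
  assumes sums: "(\<lambda>m. (1 / fact m) *s wedge_power a m) sums E"
    and ac: "a \<and>\<^sub>E c = c \<and>\<^sub>E a" and cc: "c \<and>\<^sub>E c = 0"
  shows "(\<lambda>m. (1 / fact m) *s wedge_power (c + a) m) sums ((ext_one + c) \<and>\<^sub>E E)"
proof -
  let ?t = "\<lambda>m. (1 / fact m) *s wedge_power a m"
  \<comment> \<open>The series are compared from index 1 on. The term at 0 is
    \<open>ext_one\<close>; it is subtracted here and restored at the end.\<close>
  have "(\<lambda>m. ?t (Suc m)) sums (E - ext_one)"
    using sums unfolding sums_Suc_iff[of ?t] by simp
  moreover have "(\<lambda>m. c \<and>\<^sub>E ?t m) sums (c \<and>\<^sub>E E)"
    by (rule bounded_linear.sums[OF bounded_linear_wedge_right sums])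
  ultimately have "(\<lambda>m. ?t (Suc m) + c \<and>\<^sub>E ?t m) sums (E - ext_one + c \<and>\<^sub>E E)"
    by (rule sums_add)
  moreover have "?t (Suc m) + c \<and>\<^sub>E ?t m = (1 / fact (Suc m)) *s wedge_power (c + a) (Suc m)" for m
  proof -
    have "(1 / fact (Suc m)) * of_nat (Suc m) = (1 / fact m :: complex)"
      by (simp add: divide_simps del: of_nat_Suc) 
    then show ?thesis
      unfolding wedge_power_add_square_zero[OF ac cc]
      by (simp only: wedge_scale_right vector_add_ldistrib vector_smult_assoc)
  qed
  ultimately have "(\<lambda>m. (1 / fact (Suc m)) *s wedge_power (c + a) (Suc m)) sums (E - ext_one + c \<and>\<^sub>E E)"
    by simp
  then show ?thesis
    unfolding sums_Suc_iff[of "\<lambda>m. (1 / fact m) *s wedge_power (c + a) m"]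
    by (simp add: wedge_add_left)
qed

text \<open>Induction splits off one summand at a time; it squares to zero and commutes with the sum
  of the rest, so it contributes a factor 1 + c.\<close>

lemma ext_exp_sum_list:
  fixes c :: "'j \<Rightarrow> 'n::{finite,linorder} ext"
  assumes "\<And>i j. i \<in> set js \<Longrightarrow> j \<in> set js \<Longrightarrow> c i \<and>\<^sub>E c j = c j \<and>\<^sub>E c i"
    and "\<And>j. j \<in> set js \<Longrightarrow> c j \<and>\<^sub>E c j = 0"
  shows "(\<lambda>m. (1 / fact m) *s wedge_power (\<Sum>j\<leftarrow>js. c j) m) sums wedge_list (\<lambda>j. ext_one + c j) js"
  using assms
proof (induction js)
  case Nil
  have "(\<lambda>m. (1 / fact m) *s wedge_power 0 m) = (\<lambda>m. if m = 0 then ext_one else 0 :: 'n ext)"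
  proof
    show "(1 / fact m) *s wedge_power 0 m = (if m = 0 then ext_one else 0 :: 'n ext)" for m
      by (cases m) (simp_all add: wedge_power_Suc)
  qed
  then show ?case using sums_single[of 0 "\<lambda>_. ext_one :: 'n ext"] by simp
next
  case (Cons j js)
  have "(\<Sum>i\<leftarrow>is. c i) \<and>\<^sub>E c j = c j \<and>\<^sub>E (\<Sum>i\<leftarrow>is. c i)" if "set is \<subseteq> set js" for "is"
    using that by (induction "is") (auto simp: wedge_linear Cons.prems(1))
  then show ?case
    using Cons by (auto intro!: ext_exp_sums_add)
qed

lemma ext_exp_sum:
  fixes c :: "'n::{finite,linorder} \<Rightarrow> 'n ext"
  assumes "\<And>i j. c i \<and>\<^sub>E c j = c j \<and>\<^sub>E c i" and "\<And>j. c j \<and>\<^sub>E c j = 0"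
  shows "ext_exp (\<Sum>j\<in>UNIV. c j) = wedge_list (\<lambda>j. ext_one + c j) (sorted_list_of_set UNIV)"
proof -
  have "(\<Sum>j\<in>UNIV. c j) = (\<Sum>j\<leftarrow>sorted_list_of_set UNIV. c j)"
    by (simp add: sum_list_distinct_conv_sum_set)
  then show ?thesis
    using ext_exp_sum_list[of "sorted_list_of_set UNIV" c] assms
    unfolding ext_exp_def by (simp add: sums_unique[symmetric])
qed

section \<open>Subalgebras generated by part of the coframe, and top coefficients\<close>

definition supported_in :: "'n::{finite,linorder} ext \<Rightarrow> 'n coframe set \<Rightarrow> bool" where
  "supported_in a A \<longleftrightarrow> (\<forall>K. a $ K \<noteq> 0 \<longrightarrow> K \<subseteq> A)"

lemma supported_in_mono: "supported_in a A \<Longrightarrow> A \<subseteq> B \<Longrightarrow> supported_in a B"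
  unfolding supported_in_def by blast

lemma supported_in_wedge:
  assumes "supported_in a A" "supported_in b B"
  shows "supported_in (a \<and>\<^sub>E b) (A \<union> B)"
  unfolding supported_in_def
proof (intro allI impI)
  fix K assume "(a \<and>\<^sub>E b) $ K \<noteq> 0"
  then obtain I where "I \<subseteq> K" "a $ I \<noteq> 0" "b $ (K - I) \<noteq> 0"
    unfolding wedge_nth by (metis (no_types, lifting) PowD mult_zero_left mult_zero_right sum.neutral)
  then show "K \<subseteq> A \<union> B"
    using assms unfolding supported_in_def by blast
qed

lemma supported_in_add: "supported_in a A \<Longrightarrow> supported_in b A \<Longrightarrow> supported_in (a + b) A"
  unfolding supported_in_def by (metis add.right_neutral vector_add_component)

lemma supported_in_scale: "supported_in a A \<Longrightarrow> supported_in (k *s a) A"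
  by (simp add: supported_in_def)

lemma supported_in_minus: "supported_in a A \<Longrightarrow> supported_in (- a) A"
  by (simp add: supported_in_def)

lemma supported_in_diff: "supported_in a A \<Longrightarrow> supported_in b A \<Longrightarrow> supported_in (a - b) A"
  using supported_in_add[of a A "- b"] by (simp add: supported_in_minus)

lemma supported_in_one: "supported_in ext_one A"
  by (auto simp: supported_in_def ext_one_def axis_def)

lemma supported_in_gen: "g \<in> A \<Longrightarrow> supported_in (ext_gen g) A"
  by (auto simp: supported_in_def ext_gen_def axis_def)

lemma supported_in_wedge_same: "supported_in a A \<Longrightarrow> supported_in b A \<Longrightarrow> supported_in (a \<and>\<^sub>E b) A"
  using supported_in_wedge[of a A b A] by simp

lemmas supported_in_intros = supported_in_add supported_in_scale supported_in_minus
  supported_in_diff supported_in_one supported_in_gen supported_in_wedge_same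

lemma supported_in_wedge_list:
  assumes "\<And>j. j \<in> set js \<Longrightarrow> supported_in (f j) (A j)"
  shows "supported_in (wedge_list f js) (\<Union>j\<in>set js. A j)"
  using assms by (induction js) (auto intro!: supported_in_one supported_in_wedge)

text \<open>The summands \<open>r j\<close> do not involve \<open>g j\<close>, so they cannot contribute to monomials that
  contain all \<open>g j\<close>.\<close>

lemma wedge_list_top_part:
  assumes "distinct js"
    and disj: "\<And>i j. i \<noteq> j \<Longrightarrow> A i \<inter> A j = {}"
    and gA: "\<And>j. g j \<in> A j"
    and r: "\<And>j. supported_in (r j) (A j - {g j})" and s: "\<And>j. supported_in (s j) (A j)"
    and K: "g ` set js \<subseteq> K"
  shows "wedge_list (\<lambda>j. r j + s j) js $ K = wedge_list s js $ K"
  using assms(1) K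
proof (induction js arbitrary: K)
  case (Cons j js)
  let ?R = "wedge_list (\<lambda>j. r j + s j) js" and ?S = "wedge_list s js"
  have "supported_in (r j + s j) (A j)" for j
    using supported_in_mono[OF r[of j]] s[of j] by (intro supported_in_add) blast+
  then have "supported_in ?R (\<Union>i\<in>set js. A i)"
    by (intro supported_in_wedge_list) auto
  \<comment> \<open>\<open>g j\<close> occurs neither in \<open>r j\<close> nor in the blocks of the
    later factors, so this summand has no monomial containing \<open>g j\<close>.\<close>
  with r[of j] have "supported_in (r j \<and>\<^sub>E ?R) ((A j - {g j}) \<union> (\<Union>i\<in>set js. A i))"
    by (rule supported_in_wedge)
  moreover have "g j \<notin> A i" if "i \<in> set js" for i
  proof -
    have "i \<noteq> j" using Cons.prems(1) that by auto
    then show ?thesis using disj[of i j] gA[of j] by blast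
  qed
  then have "g j \<notin> (A j - {g j}) \<union> (\<Union>i\<in>set js. A i)"
    by blast
  moreover have "g j \<in> K"
    using Cons.prems(2) by simp
  ultimately have "(r j \<and>\<^sub>E ?R) $ K = 0"
    unfolding supported_in_def by blast
  \<comment> \<open>The part \<open>I\<close> taken by \<open>s j\<close> lies in
    \<open>A j\<close>, away from the other \<open>g i\<close>. Hence \<open>K - I\<close> still
    contains all of these and the induction hypothesis applies to it.\<close>
  moreover have "(s j \<and>\<^sub>E ?R) $ K = (s j \<and>\<^sub>E ?S) $ K"
    unfolding wedge_nth
  proof (intro sum.cong refl)
    fix I assume "I \<in> Pow K"
    show "wedge_sign I (K - I) * s j $ I * ?R $ (K - I) = wedge_sign I (K - I) * s j $ I * ?S $ (K - I)"
    proof (cases "s j $ I = 0")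
      case False
      then have "I \<subseteq> A j" using s[of j] unfolding supported_in_def by blast
      moreover have "g i \<notin> A j" if "i \<in> set js" for i
      proof -
        have "i \<noteq> j" using Cons.prems(1) that by auto
        then show ?thesis using disj[of i j] gA[of i] by blast
      qed
      ultimately have "g ` set js \<subseteq> K - I"
        using Cons.prems(2) by auto
      then have "?R $ (K - I) = ?S $ (K - I)"
        using Cons.prems(1) by (intro Cons.IH) simp_all
      then show ?thesis by simp
    qed simp
  qed
  ultimately show ?case by (simp add: wedge_add_left)
qed simp

text \<open>The top coefficient only sees monomials containing \<open>G\<close>, so agreement there
  is enough. The sign in \<open>top_coeff\<close> undoes the sign of wedging with
  \<open>axis G 1\<close>, since signs square to 1.\<close>

lemma top_coeff_wedge_axis:
  assumes "\<And>K. G \<subseteq> K \<Longrightarrow> a $ K = (b \<and>\<^sub>E axis G 1) $ K" "supported_in b (- G)"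
  shows "top_coeff G a = b"
proof -
  have "top_coeff G a $ A = b $ A" for A
  proof (cases "A \<inter> G = {}")
    case True
    then have "(A \<union> G) - G = A" by auto
    then show ?thesis
      using True assms(1)[of "A \<union> G"]
      by (simp add: top_coeff_def wedge_axis_right_nth flip: mult.assoc)
  next
    case False
    then show ?thesis using assms(2) by (auto simp: top_coeff_def supported_in_def)
  qed
  then show ?thesis by (simp add: vec_eq_iff)
qed

lemma top_coeff_scale: "top_coeff G (k *s a) = k *s top_coeff G a"
  by (simp add: top_coeff_def vec_eq_iff)

section \<open>Exponentials of \<open>omega_X\<close> and \<open>curv_F\<close>, and top
  coefficients of the products\<close>

lemma gen_pair_commute:
  "(ext_gen g \<and>\<^sub>E ext_gen h) \<and>\<^sub>E ext_gen k = ext_gen k \<and>\<^sub>E (ext_gen g \<and>\<^sub>E ext_gen h)"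
proof -
  have "(ext_gen g \<and>\<^sub>E ext_gen h) \<and>\<^sub>E ext_gen k = - (ext_gen g \<and>\<^sub>E (ext_gen k \<and>\<^sub>E ext_gen h))"
    by (simp add: wedge_assoc ext_gen_anticommute[of h k] wedge_minus_right)
  also have "\<dots> = - ((ext_gen g \<and>\<^sub>E ext_gen k) \<and>\<^sub>E ext_gen h)"
    by (simp add: wedge_assoc)
  also have "\<dots> = ext_gen k \<and>\<^sub>E (ext_gen g \<and>\<^sub>E ext_gen h)"
    by (simp add: ext_gen_anticommute[of g k] wedge_minus_left wedge_assoc)
  finally show ?thesis .
qed

lemma gen_pair_commute_wedge:
  "(ext_gen g \<and>\<^sub>E ext_gen h) \<and>\<^sub>E (ext_gen k \<and>\<^sub>E a) = ext_gen k \<and>\<^sub>E ((ext_gen g \<and>\<^sub>E ext_gen h) \<and>\<^sub>E a)"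
  using arg_cong[OF gen_pair_commute[of g h k], of "\<lambda>x. x \<and>\<^sub>E a"] by (simp only: wedge_assoc)

lemma gen_pair_commute_pair:
  "(ext_gen g \<and>\<^sub>E ext_gen h) \<and>\<^sub>E (ext_gen k \<and>\<^sub>E ext_gen l) =
   (ext_gen k \<and>\<^sub>E ext_gen l) \<and>\<^sub>E (ext_gen g \<and>\<^sub>E ext_gen h)"
  unfolding gen_pair_commute_wedge[of g h k "ext_gen l"] gen_pair_commute[of g h l]
  by (rule wedge_assoc[symmetric])

text \<open>The repeated generator \<open>h\<close> meets itself once the even pair is moved past
  \<open>k\<close>. This kills the squares of the two-forms and the mixed products sharing
  du_j.\<close>

lemma gen_pair_repeat:
  "(ext_gen g \<and>\<^sub>E ext_gen h) \<and>\<^sub>E (ext_gen k \<and>\<^sub>E ext_gen h) = 0"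
  by (metis ext_gen_square gen_pair_commute_wedge wedge_assoc wedge_zero_right)

lemma gen_pair_smult_commute:
  "(c *s (ext_gen g \<and>\<^sub>E ext_gen h)) \<and>\<^sub>E (d *s (ext_gen k \<and>\<^sub>E ext_gen l)) =
   (d *s (ext_gen k \<and>\<^sub>E ext_gen l)) \<and>\<^sub>E (c *s (ext_gen g \<and>\<^sub>E ext_gen h))"
  unfolding wedge_scale_left wedge_scale_right gen_pair_commute_pair[of g h]
  by (simp add: vector_smult_assoc mult.commute)

lemma ext_exp_omega_X: "ext_exp (\<i> *s omega_X :: 'n::{finite,linorder} ext) =
  wedge_list (\<lambda>j. ext_one + \<i> *s (ext_gen (DX j) \<and>\<^sub>E ext_gen (DU j))) (sorted_list_of_set UNIV)"
proof -
  have "\<i> *s omega_X = (\<Sum>j\<in>(UNIV :: 'n set). \<i> *s (ext_gen (DX j) \<and>\<^sub>E ext_gen (DU j)))"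
    by (simp add: omega_X_def vec.scale_sum_right)
  then show ?thesis
    by (simp only:) (rule ext_exp_sum, rule gen_pair_smult_commute,
      simp only: wedge_scale_left wedge_scale_right gen_pair_repeat vector_smult_rzero)
qed

text \<open>The scalar \<open>s\<close> is kept general to serve both kernels, e^(iF) and
  e^(-iF).\<close>

lemma ext_exp_curv_F: "ext_exp (s *s curv_F :: 'n::{finite,linorder} ext) =
  wedge_list (\<lambda>j. ext_one + (s * \<i>) *s (ext_gen (DY j) \<and>\<^sub>E ext_gen (DU j))) (sorted_list_of_set UNIV)"
proof -
  have "s *s curv_F = (\<Sum>j\<in>(UNIV :: 'n set). (s * \<i>) *s (ext_gen (DY j) \<and>\<^sub>E ext_gen (DU j)))"
    by (simp add: curv_F_def vec.scale_sum_right vector_smult_assoc)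
  then show ?thesis
    by (simp only:) (rule ext_exp_sum, rule gen_pair_smult_commute,
      simp only: wedge_scale_left wedge_scale_right gen_pair_repeat vector_smult_rzero)
qed

lemma strict_mono_coframe: "strict_mono DX" "strict_mono DY" "strict_mono DU"
  by (auto simp: strict_mono_def less_coframe_def less_eq_coframe_def)

abbreviation Omega_factor :: "'n::{finite,linorder} \<Rightarrow> 'n ext" where
  "Omega_factor j \<equiv> - ext_gen (DX j) - \<i> *s ext_gen (DY j)"

lemma Omega_Y_eq: "Omega_Y = wedge_list Omega_factor (sorted_list_of_set UNIV)"
  by (simp add: Omega_Y_def ordered_wedge_def wedge_list_def)

lemma smult_diff_minus: "c *s (a + b) = c *s a + c *s b" "c *s (a - b) = c *s a - c *s b"
   "c *s (- a) = - (c *s a)" "(- c) *s a = - (c *s a)" for a b :: "complex ^ 'm"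
  by (simp_all add: vec_eq_iff algebra_simps)

text \<open>Factor by factor, (1 + i dx_j ^ du_j) ^ (1 - dy_j ^ du_j) = 1 - i theta_j ^ du_j with
  theta_j = \<open>Omega_factor j\<close>; the cross term vanishes because du_j repeats. Only the
  product of the second summands contains every du_j, and collecting the du_j on the right yields
  the sign.\<close>

lemma top_coeff_exp_omega_X_curv_F:
  "top_coeff (range DU) (ext_exp (\<i> *s omega_X) \<and>\<^sub>E ext_exp (\<i> *s curv_F)) =
   ((-1) ^ (CARD('n) * (CARD('n) - 1) div 2) * (- \<i>) ^ CARD('n)) *s (Omega_Y :: 'n::{finite,linorder} ext)"
proof -
  let ?L = "sorted_list_of_set (UNIV :: 'n set)"
  let ?s = "\<lambda>j::'n. (- \<i>) *s (Omega_factor j \<and>\<^sub>E ext_gen (DU j))"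
  let ?a = "\<lambda>j::'n. \<i> *s (ext_gen (DX j) \<and>\<^sub>E ext_gen (DU j))"
    and ?b = "\<lambda>j::'n. (\<i> * \<i>) *s (ext_gen (DY j) \<and>\<^sub>E ext_gen (DU j))"
  have commute: "(ext_one + ?b i) \<and>\<^sub>E (ext_one + ?a j) = (ext_one + ?a j) \<and>\<^sub>E (ext_one + ?b i)" for i j
    unfolding wedge_add_left wedge_add_right gen_pair_smult_commute[of _ "DY i"]
    by (simp add: add_ac)
  have factor: "(ext_one + ?a j) \<and>\<^sub>E (ext_one + ?b j) = ext_one + ?s j" for j
  proof -
    have "?a j \<and>\<^sub>E ?b j = 0"
      by (simp only: wedge_scale_left wedge_scale_right gen_pair_repeat vector_smult_rzero)
    then show ?thesis
      by (simp add: wedge_add_left wedge_add_right) (simp add: wedge_linear smult_diff_minus vector_smult_assoc)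
  qed
  have "ext_exp (\<i> *s omega_X) \<and>\<^sub>E ext_exp (\<i> *s curv_F) = wedge_list (\<lambda>j. ext_one + ?s j) ?L"
    unfolding ext_exp_omega_X ext_exp_curv_F
    by (subst wedge_list_mult) (rule commute, simp only: factor)
  moreover have "wedge_list (\<lambda>j. ext_one + ?s j) ?L $ K = wedge_list ?s ?L $ K"
    if "range DU \<subseteq> K" for K
    using that
    by (intro wedge_list_top_part[where g = DU and A = "\<lambda>j. {DX j, DY j, DU j}"])
      (auto intro!: supported_in_intros)
  moreover have "wedge_list ?s ?L = ((-1) ^ (CARD('n) * (CARD('n) - 1) div 2) * (- \<i>) ^ CARD('n)) *s
      (Omega_Y \<and>\<^sub>E axis (range DU) 1)"
  proof -
    have anti: "ext_gen (DU i) \<and>\<^sub>E Omega_factor j = - (Omega_factor j \<and>\<^sub>E ext_gen (DU i))" for i j :: 'n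
      by (simp add: wedge_linear ext_gen_anticommute[of "DU i"])
    have "wedge_list (\<lambda>j::'n. ext_gen (DU j)) ?L = axis (range DU) 1"
      by (subst wedge_list_gens) (simp_all add: strict_mono_coframe)
    then show ?thesis
      unfolding wedge_list_scale wedge_list_mult_anticommute[of ?L "\<lambda>j. ext_gen (DU j)" Omega_factor, OF anti]
      by (simp add: Omega_Y_eq vector_smult_assoc mult.commute)
  qed
  moreover have "supported_in (Omega_Y :: 'n ext) (- range DU)"
    using supported_in_wedge_list[of ?L Omega_factor "\<lambda>_. - range DU"]
    by (auto simp: Omega_Y_eq intro!: supported_in_intros)
  ultimately show ?thesis
    by (intro top_coeff_wedge_axis supported_in_scale) (simp_all only: wedge_scale_left)
qed

text \<open>In each factor the summand - dx_j lacks dy_j and is discarded. The remaining 1 + i dx_j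
  ^ du_j are even, so pulling the dy_j out to the right costs no sign.\<close>

lemma top_coeff_Omega_Y_exp_curv_F:
  "top_coeff (range DY) (Omega_Y \<and>\<^sub>E ext_exp (- (\<i> *s curv_F))) =
   (- \<i>) ^ CARD('n) *s ext_exp (\<i> *s (omega_X :: 'n::{finite,linorder} ext))"
proof -
  let ?L = "sorted_list_of_set (UNIV :: 'n set)"
  let ?e = "\<lambda>j::'n. ext_one + \<i> *s (ext_gen (DX j) \<and>\<^sub>E ext_gen (DU j))"
  let ?s = "\<lambda>j::'n. (- \<i>) *s (?e j \<and>\<^sub>E ext_gen (DY j))"
  have F: "- (\<i> *s curv_F) = (- \<i>) *s curv_F"
    by (simp add: smult_diff_minus)
  let ?b = "\<lambda>j::'n. ext_one + (- \<i> * \<i>) *s (ext_gen (DY j) \<and>\<^sub>E ext_gen (DU j))"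
  have commute: "?b i \<and>\<^sub>E Omega_factor j = Omega_factor j \<and>\<^sub>E ?b i" for i j
    by (simp add: wedge_add_left wedge_add_right wedge_diff_left wedge_diff_right wedge_minus_left
        wedge_minus_right wedge_scale_left wedge_scale_right gen_pair_commute)
  have factor: "Omega_factor j \<and>\<^sub>E ?b j = - ext_gen (DX j) + ?s j" for j
  proof -
    \<comment> \<open>The cubic term of the product is rewritten with dy_j last, the position from
      which it is integrated out.\<close>
    have "(ext_gen (DX j) \<and>\<^sub>E ext_gen (DU j)) \<and>\<^sub>E ext_gen (DY j) =
        - (ext_gen (DX j) \<and>\<^sub>E (ext_gen (DY j) \<and>\<^sub>E ext_gen (DU j)))"
      by (simp only: wedge_assoc ext_gen_anticommute[of "DU j" "DY j"] wedge_minus_right)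
    moreover have "ext_gen (DY j) \<and>\<^sub>E (ext_gen (DY j) \<and>\<^sub>E ext_gen (DU j)) = 0"
      by (simp flip: wedge_assoc)
    ultimately show ?thesis
      by (simp add: wedge_linear)
  qed
  have "Omega_Y \<and>\<^sub>E ext_exp (- (\<i> *s curv_F)) = wedge_list (\<lambda>j. - ext_gen (DX j) + ?s j) ?L"
    unfolding F ext_exp_curv_F Omega_Y_eq
    by (subst wedge_list_mult) (rule commute, simp only: factor)
  moreover have "wedge_list (\<lambda>j. - ext_gen (DX j) + ?s j) ?L $ K = wedge_list ?s ?L $ K"
    if "range DY \<subseteq> K" for K
    using that
    by (intro wedge_list_top_part[where g = DY and A = "\<lambda>j. {DX j, DY j, DU j}"])
      (auto intro!: supported_in_intros)
  moreover have "wedge_list ?s ?L = (- \<i>) ^ CARD('n) *s (ext_exp (\<i> *s omega_X) \<and>\<^sub>E axis (range DY) 1)"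
  proof -
    have commute: "ext_gen (DY i) \<and>\<^sub>E ?e j = ?e j \<and>\<^sub>E ext_gen (DY i)" for i j
      by (simp add: wedge_add_left wedge_add_right wedge_scale_left wedge_scale_right gen_pair_commute)
    have "wedge_list (\<lambda>j::'n. ext_gen (DY j)) ?L = axis (range DY) 1"
      by (subst wedge_list_gens) (simp_all add: strict_mono_coframe)
    then show ?thesis
      unfolding wedge_list_scale ext_exp_omega_X
        wedge_list_mult[of ?L "\<lambda>j. ext_gen (DY j)" ?e, OF commute, symmetric]
      by simp
  qed
  moreover have "supported_in (ext_exp (\<i> *s (omega_X :: 'n ext))) (- range DY)"
    using supported_in_wedge_list[of ?L ?e "\<lambda>_. - range DY"]
    by (auto simp: ext_exp_omega_X intro!: supported_in_intros)
  ultimately show ?thesis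
    by (intro top_coeff_wedge_axis supported_in_scale) (simp_all only: wedge_scale_left)
qed

section \<open>Laurent expansion of the exponential of the superpotential\<close>

text \<open>The product of finitely many absolutely convergent exponential series is expanded into
  one sum over exponent functions \<open>k\<close>.\<close>

lemma exp_power_series_has_sum:
  fixes a :: "'i::finite \<Rightarrow> complex"
  shows "((\<lambda>k. \<Prod>i\<in>UNIV. a i ^ k i / fact (k i)) has_sum exp (\<Sum>i\<in>UNIV. a i)) UNIV"
proof -
  have abs: "(\<lambda>n. norm (a i ^ n / fact n)) summable_on UNIV" for i
  proof -
    have "(\<lambda>n. norm (a i) ^ n / fact n) sums exp (norm (a i))"
      using exp_converges[of "norm (a i)"] by (simp add: field_simps)
    then have "((\<lambda>n. norm (a i) ^ n / fact n) has_sum exp (norm (a i))) UNIV"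
      by (rule sums_nonneg_imp_has_sum) simp
    then show ?thesis
      by (auto simp: norm_divide norm_power dest: has_sum_imp_summable)
  qed
  have exp1: "infsum (\<lambda>n. a i ^ n / fact n) UNIV = exp (a i)" for i
  proof -
    have "a i ^ n / fact n = a i ^ n /\<^sub>R fact n" for n
      by (simp add: scaleR_conv_of_real divide_inverse)
    then have "(\<lambda>n. a i ^ n / fact n) sums exp (a i)"
      using exp_converges[of "a i"] by simp
    moreover have "(\<lambda>n. a i ^ n / fact n) sums infsum (\<lambda>n. a i ^ n / fact n) UNIV"
      by (rule has_sum_imp_sums[OF has_sum_infsum[OF abs_summable_summable[OF abs]]])
    ultimately show ?thesis
      by (rule sums_unique2[symmetric])
  qed
  have "infsum (\<lambda>k. \<Prod>i\<in>UNIV. a i ^ k i / fact (k i)) (PiE UNIV (\<lambda>_. UNIV)) =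
      (\<Prod>i\<in>UNIV. infsum (\<lambda>n. a i ^ n / fact n) UNIV)"
    by (rule infsum_prod_PiE_abs) (use abs in auto)
  then have infsum: "infsum (\<lambda>k. \<Prod>i\<in>UNIV. a i ^ k i / fact (k i)) UNIV = exp (\<Sum>i\<in>UNIV. a i)"
    by (simp add: exp1 exp_sum PiE_UNIV_domain)
  \<comment> \<open>\<open>infsum\<close> is 0 for a family that is not summable, whereas the value
    just found is an exponential and hence nonzero.\<close>
  have "(\<lambda>k. \<Prod>i\<in>UNIV. a i ^ k i / fact (k i)) summable_on UNIV"
  proof (rule ccontr)
    assume "\<not> ?thesis"
    from infsum_not_exists[OF this] infsum show False by simp
  qed
  from has_sum_infsum[OF this] show ?thesis
    unfolding infsum .
qed

section \<open>Polar coordinates and Laurent monomials\<close>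

lemma of_N_add: "of_N (u + w) = of_N u + of_N w"
  by (simp add: of_N_def vec_eq_iff)

lemma of_N_disc_boundary:
  fixes v :: "'n + 'l::finite \<Rightarrow> int^'n"
  shows   "of_N (disc_boundary v k) = (\<Sum>i\<in>UNIV. real_of_int (k i) *\<^sub>R of_N (v i))"
  by (simp add: of_N_def disc_boundary_def vec_eq_iff)

lemma nu_proj_Y_point [simp]: "nu_proj (Y_point x y) = x"
  by (simp add: nu_proj_def Y_point_def vec_eq_iff)

lemma Y_point_nonzero [simp]: "Y_point x y $ j \<noteq> 0"
  by (simp add: Y_point_def)

lemma Y_point_polar:
  assumes "\<And>j. z $ j \<noteq> 0"
  shows "Y_point (nu_proj z) (y_coord z) = z"
proof -
  have "exp (of_real (ln (cmod (z $ j))) + \<i> * of_real (Arg (z $ j))) = z $ j" for j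
    using assms[of j] Arg_eq[of "z $ j"] by (simp add: exp_add exp_of_real)
  then show ?thesis
    by (simp add: Y_point_def nu_proj_def y_coord_def vec_eq_iff)
qed

lemma zpow_Y_point:
  "zpow (Y_point x y) w = exp (- of_real (x \<bullet> of_N w) - \<i> * of_real (y \<bullet> of_N w))"
proof -
  have "zpow (Y_point x y) w =
      (\<Prod>j\<in>UNIV. exp (of_int (w $ j) * (- of_real (x $ j) - \<i> * of_real (y $ j))))"
    by (simp add: zpow_def Y_point_def exp_power_int)
  also have "\<dots> = exp (\<Sum>j\<in>UNIV. of_int (w $ j) * (- of_real (x $ j) - \<i> * of_real (y $ j)))"
    by (simp add: exp_sum)
  also have "(\<Sum>j\<in>UNIV. of_int (w $ j) * (- of_real (x $ j) - \<i> * of_real (y $ j))) =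
      - of_real (x \<bullet> of_N w) - \<i> * of_real (y \<bullet> of_N w)"
    by (simp add: inner_vec_def of_N_def algebra_simps sum_subtractf sum_negf sum_distrib_left)
  finally show ?thesis .
qed

text \<open>\<open>hol\<close> uses the angles chosen by \<open>y_coord\<close>, which may differ
  from \<open>y\<close> by multiples of 2 pi. Comparing the two resulting expressions for z^w and
  cancelling e^(- <x, w>) shows that the choice is immaterial.\<close>

lemma hol_Y_point: "hol (p, w) (Y_point x y) = exp (- \<i> * of_real (y \<bullet> of_N w))"
proof -
  have "Y_point x (y_coord (Y_point x y)) = Y_point x y"
    using Y_point_polar[of "Y_point x y"] by simp
  then have "zpow (Y_point x (y_coord (Y_point x y))) w = zpow (Y_point x y) w"
    by simp
  then show ?thesis
    by (simp add: zpow_Y_point hol_def exp_diff exp_minus)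
qed

lemma zpow_disc_boundary:
  fixes v :: "'n + 'l::finite \<Rightarrow> int^'n"
  assumes "\<And>j. z $ j \<noteq> 0"
  shows "zpow z (disc_boundary v (\<lambda>i. int (k i))) = (\<Prod>i\<in>UNIV. zpow z (v i) ^ k i)"
proof -
  define x y where "x = nu_proj z" and "y = y_coord z"
  have z: "z = Y_point x y"
    using Y_point_polar[OF assms] by (simp add: x_def y_def)
  have "(\<Prod>i\<in>UNIV. zpow z (v i) ^ k i) =
      exp (\<Sum>i\<in>UNIV. of_nat (k i) * (- of_real (x \<bullet> of_N (v i)) - \<i> * of_real (y \<bullet> of_N (v i))))"
    by (simp add: z zpow_Y_point exp_sum exp_of_nat_mult)
  also have "(\<Sum>i\<in>UNIV. of_nat (k i) * (- of_real (x \<bullet> of_N (v i)) - \<i> * of_real (y \<bullet> of_N (v i)))) =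
      - of_real (x \<bullet> of_N (disc_boundary v (\<lambda>i. int (k i)))) -
        \<i> * of_real (y \<bullet> of_N (disc_boundary v (\<lambda>i. int (k i))))"
    by (simp add: of_N_disc_boundary inner_sum_right algebra_simps sum_subtractf sum_negf sum_distrib_left)
  finally show ?thesis
    by (simp add: z zpow_Y_point)
qed

section \<open>The coefficients of \<open>Phi\<close> and the two series for e^W\<close>

definition disc_weight :: "real^'l \<Rightarrow> ('n + 'l \<Rightarrow> nat) \<Rightarrow> real" where
  "disc_weight q k = (\<Prod>i\<in>UNIV. exp (lambda_of q i) ^ k i / fact (k i))"

text \<open>This is the constant f_w that admissibility asks for: the value of \<open>Phi\<close> at
  \<open>w\<close> with the factor e^(- <x, w>) removed.\<close>

definition Phi_coeff :: "('n + 'l \<Rightarrow> int^'n) \<Rightarrow> real^'l \<Rightarrow> int^'n \<Rightarrow> real" where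
  "Phi_coeff v q w = (\<Sum>\<^sub>\<infinity>k\<in>{k. disc_boundary v (\<lambda>i. int (k i)) = w}. disc_weight q k)"

text \<open>The area is linear in \<open>k\<close>: its \<lambda> part becomes a weight independent
  of the point, and its x part depends on \<open>k\<close> only through the boundary.\<close>

lemma Phi_term_eq:
  fixes v :: "'n + 'l::finite \<Rightarrow> int^'n"
  shows   "Phi_term v q \<xi> k =
    disc_weight q k * exp (- (moment_map \<xi> \<bullet> of_N (disc_boundary v (\<lambda>i. int (k i)))))"
proof -
  define x where "x = moment_map \<xi>"
  have "- (1 / (2 * pi)) * disc_area v q x (\<lambda>i. int (k i)) =
      (\<Sum>i\<in>UNIV. of_nat (k i) * lambda_of q i) + - (x \<bullet> of_N (disc_boundary v (\<lambda>i. int (k i))))"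
    by (simp add: disc_area_def of_N_disc_boundary inner_sum_right sum_distrib_left
        flip: sum_negf sum.distrib) (simp add: field_simps)
  then have "exp (- (1 / (2 * pi)) * disc_area v q x (\<lambda>i. int (k i))) =
      (\<Prod>i\<in>UNIV. exp (lambda_of q i) ^ k i) * exp (- (x \<bullet> of_N (disc_boundary v (\<lambda>i. int (k i)))))"
    by (simp only: exp_add exp_sum finite exp_of_nat_mult)
  then show ?thesis
    by (simp add: Phi_term_def disc_weight_def x_def prod_dividef)
qed

lemma exp_superpotential_disc_series:
  fixes v :: "'n + 'l::finite \<Rightarrow> int^'n"
  assumes "\<And>j. z $ j \<noteq> 0"
  shows "((\<lambda>k. of_real (disc_weight q k) * zpow z (disc_boundary v (\<lambda>i. int (k i))))
    has_sum exp (superpotential v q z)) UNIV"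
  using exp_power_series_has_sum[of "\<lambda>i. of_real (exp (lambda_of q i)) * zpow z (v i)"]
  by (simp add: superpotential_def zpow_disc_boundary[OF assms] disc_weight_def power_mult_distrib
      prod.distrib prod_dividef)

text \<open>The terms are the absolute values of those in the series for e^W at the point over x
  with angle 0, and a summable complex family is absolutely summable.\<close>

lemma Phi_term_summable:
  fixes v :: "'n + 'l::finite \<Rightarrow> int^'n"
  shows "Phi_term v q \<xi> summable_on A"
proof -
  let ?f = "\<lambda>k. of_real (disc_weight q k) * zpow (Y_point (moment_map \<xi>) 0) (disc_boundary v (\<lambda>i. int (k i)))"
  have "?f summable_on UNIV"
    using exp_superpotential_disc_series[of "Y_point (moment_map \<xi>) 0"] by (auto intro: has_sum_imp_summable)
  then have "(\<lambda>k. norm (?f k)) summable_on UNIV"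
    by (simp only: summable_on_iff_abs_summable_on_complex)
  moreover have "disc_weight q k \<ge> 0" for k :: "'n + 'l \<Rightarrow> nat"
    by (auto simp: disc_weight_def intro!: prod_nonneg)
  then have "norm (?f k) = Phi_term v q \<xi> k" for k
    by (simp add: norm_mult cmod_zpow Phi_term_eq)
  ultimately show ?thesis
    by (auto intro: summable_on_subset_banach)
qed

lemma disc_weight_summable: "disc_weight q summable_on A"
  for q :: "real^'l" and A :: "('n::finite + 'l \<Rightarrow> nat) set"
proof -
  \<comment> \<open>With all rays set to 0 the boundary is 0 and its exponential factor is 1, so
    only the weight remains.\<close>
  have "Phi_term (\<lambda>_. 0) q ((0 :: real^'n, 0), 0) = disc_weight q"
    by (simp add: fun_eq_iff Phi_term_eq moment_map_def)
  then show ?thesis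
    using Phi_term_summable by metis
qed

lemma Phi_eq:
  fixes v :: "'n + 'l::finite \<Rightarrow> int^'n"
  shows   "Phi v q (p, w) = of_real (Phi_coeff v q w) * of_real (exp (- (moment_map (p, w) \<bullet> of_N w)))"
proof -
  have "(\<Sum>\<^sub>\<infinity>k\<in>Phi_classes v (p, w). Phi_term v q (p, w) k) =
      (\<Sum>\<^sub>\<infinity>k\<in>Phi_classes v (p, w). disc_weight q k * exp (- (moment_map (p, w) \<bullet> of_N w)))"
    by (rule infsum_cong) (simp add: Phi_classes_def Phi_term_eq)
  then show ?thesis
    by (simp add: Phi_def infsum_cmult_left' Phi_coeff_def Phi_classes_def)
qed

text \<open>The series over \<open>k\<close> is grouped along the fibres of the boundary map; the
  weights over the fibre of \<open>w\<close> add up to \<open>Phi_coeff v q w\<close>.\<close>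

lemma exp_superpotential_lattice_series:
  fixes v :: "'n + 'l::finite \<Rightarrow> int^'n"
  assumes "\<And>j. z $ j \<noteq> 0"
  shows "((\<lambda>w. of_real (Phi_coeff v q w) * zpow z w) has_sum exp (superpotential v q z)) UNIV"
proof -
  let ?bd = "\<lambda>k. disc_boundary v (\<lambda>i. int (k i))"
  let ?f = "\<lambda>(w, k). of_real (disc_weight q k) * zpow z w"
  have bij: "bij_betw (\<lambda>k. (?bd k, k)) UNIV (SIGMA w:UNIV. {k. ?bd k = w})"
    by (rule bij_betw_byWitness[where f' = snd]) auto
  have "((\<lambda>k. ?f (?bd k, k)) has_sum exp (superpotential v q z)) UNIV"
    using exp_superpotential_disc_series[OF assms] by simp
  then have "(?f has_sum exp (superpotential v q z)) (SIGMA w:UNIV. {k. ?bd k = w})"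
    by (rule iffD1[OF has_sum_reindex_bij_betw[OF bij]])
  then show ?thesis
  proof (rule has_sum_SigmaD)
    fix w
    have "(disc_weight q has_sum Phi_coeff v q w) {k. ?bd k = w}"
      unfolding Phi_coeff_def by (rule has_sum_infsum[OF disc_weight_summable])
    then have "((\<lambda>k. of_real (disc_weight q k) * zpow z w) has_sum of_real (Phi_coeff v q w) * zpow z w)
        {k. ?bd k = w}"
      by (intro has_sum_cmult_left has_sum_of_real)
    then show "((\<lambda>k. ?f (w, k)) has_sum of_real (Phi_coeff v q w) * zpow z w) {k. ?bd k = w}"
      by simp
  qed
qed

section \<open>Fourier coefficients\<close>

text \<open>Fubini for a product of functions of one coordinate each, obtained by passing to the
  Lebesgue integral and viewing \<open>lborel\<close> as the image of a product measure.\<close>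

lemma integral_cbox_prod:
  fixes l u :: "'a::euclidean_space" and g :: "'a \<Rightarrow> real \<Rightarrow> complex"
  assumes cont: "\<And>b. b \<in> Basis \<Longrightarrow> continuous_on {l \<bullet> b..u \<bullet> b} (g b)"
  shows "integral (cbox l u) (\<lambda>x. \<Prod>b\<in>Basis. g b (x \<bullet> b)) =
    (\<Prod>b\<in>Basis. integral {l \<bullet> b..u \<bullet> b} (g b))"
proof -
  \<comment> \<open>Indicators turn the integrals over the box and the intervals into integrals over
    whole spaces; they factor with the integrand because a box is a product of intervals.\<close>
  let ?F = "\<lambda>x. indicator (cbox l u) x *\<^sub>R (\<Prod>b\<in>Basis. g b (x \<bullet> b))"
  let ?G = "\<lambda>b t. indicator {l \<bullet> b..u \<bullet> b} t *\<^sub>R g b t"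
  have "continuous_on (cbox l u) (\<lambda>x. g b (x \<bullet> b))" if "b \<in> Basis" for b
    using that by (intro continuous_on_compose2[OF cont]) (auto intro!: continuous_intros simp: mem_box)
  then have F: "integrable lborel ?F"
    by (intro borel_integrable_compact continuous_on_prod) auto
  have G: "integrable lborel (?G b)" if "b \<in> Basis" for b
    using cont[OF that] by (intro borel_integrable_compact) auto
  interpret product_sigma_finite "\<lambda>_ :: 'a. lborel :: real measure" ..
  have FG: "?F (\<Sum>b\<in>Basis. f b *\<^sub>R b) = (\<Prod>b\<in>Basis. ?G b (f b))" for f
  proof (cases "\<forall>b\<in>Basis. f b \<in> {l \<bullet> b..u \<bullet> b}")
    case True
    then show ?thesis by (auto simp: mem_box indicator_def)
  next
    case False
    then obtain b where "b \<in> Basis" "f b \<notin> {l \<bullet> b..u \<bullet> b}" by blast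
    then have "(\<Prod>b\<in>Basis. ?G b (f b)) = 0" "(\<Sum>b\<in>Basis. f b *\<^sub>R b) \<notin> cbox l u"
      by (auto simp: mem_box intro!: prod_zero bexI[of _ b])
    then show ?thesis by simp
  qed
  have "integral (cbox l u) (\<lambda>x. \<Prod>b\<in>Basis. g b (x \<bullet> b)) = integral\<^sup>L lborel ?F"
    using set_borel_integral_eq_integral(2)[of "cbox l u" "\<lambda>x. \<Prod>b\<in>Basis. g b (x \<bullet> b)"] F
    by (simp add: set_integrable_def set_lebesgue_integral_def)
  also have "\<dots> = integral\<^sup>L (\<Pi>\<^sub>M b\<in>Basis. lborel) (\<lambda>f. ?F (\<Sum>b\<in>Basis. f b *\<^sub>R b))"
    using borel_measurable_integrable[OF F] by (subst lborel_eq) (intro integral_distr; simp)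
  also have "\<dots> = (\<Prod>b\<in>Basis. integral\<^sup>L lborel (?G b))"
    unfolding FG using G by (intro product_integral_prod) auto
  also have "\<dots> = (\<Prod>b\<in>Basis. integral {l \<bullet> b..u \<bullet> b} (g b))"
  proof (intro prod.cong refl)
    fix b :: 'a assume "b \<in> Basis"
    then show "integral\<^sup>L lborel (?G b) = integral {l \<bullet> b..u \<bullet> b} (g b)"
      using set_borel_integral_eq_integral(2)[of "{l \<bullet> b..u \<bullet> b}" "g b"] G[of b]
      by (simp add: set_integrable_def set_lebesgue_integral_def)
  qed
  finally show ?thesis .
qed

text \<open>For m \<noteq> 0 the antiderivative e^(imt) / (im) takes the same value at 0 and at 2
  pi.\<close>

lemma integral_character_circle:
  "integral {0..2 * pi} (\<lambda>t. exp (\<i> * of_real (t * of_int m))) = (if m = 0 then 2 * of_real pi else 0)"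
proof (cases "m = 0")
  case False
  have "((\<lambda>t. exp (\<i> * of_real (t * of_int m))) has_integral
      (exp (\<i> * of_real (2 * pi * of_int m)) / (\<i> * of_int m) - exp (\<i> * of_real (0 * of_int m)) / (\<i> * of_int m)))
      {0..2 * pi}"
    using False
    by (intro fundamental_theorem_of_calculus)
      (auto intro!: derivative_eq_intros has_vector_derivative_real_field simp: field_simps)
  moreover have "exp (\<i> * of_real (2 * pi * of_int m)) = 1"
    using exp_integer_2pi[of "of_int m"] by (simp add: mult_ac)
  ultimately show ?thesis
    using False by (simp add: integral_unique)
qed (simp add: scaleR_conv_of_real)

text \<open>The character is a product of characters of single coordinates, so one nonzero
  coordinate of \<open>w\<close> makes the integral vanish.\<close>

lemma integral_character:
  "integral angle_box (\<lambda>y. exp (\<i> * of_real (y \<bullet> of_N w))) =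
    (if w = 0 then (2 * of_real pi) ^ CARD('n) else 0)" for w :: "int^'n"
proof -
  have basis: "(\<Prod>b\<in>(Basis :: (real^'n) set). h b) = (\<Prod>j\<in>UNIV. h (axis j 1))" for h :: "real^'n \<Rightarrow> complex"
  proof -
    have Basis: "(Basis :: (real^'n) set) = range (\<lambda>j. axis j 1)"
      by (auto simp: Basis_vec_def)
    show ?thesis
      unfolding Basis by (subst prod.reindex) (auto simp: inj_on_def axis_eq_axis)
  qed
  have eq: "exp (\<i> * of_real (y \<bullet> of_N w)) = (\<Prod>b\<in>Basis. exp (\<i> * of_real ((y \<bullet> b) * (of_N w \<bullet> b))))"
    for y :: "real^'n"
    by (subst euclidean_inner) (simp add: exp_sum sum_distrib_left)
  have "integral angle_box (\<lambda>y. exp (\<i> * of_real (y \<bullet> of_N w))) =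
      (\<Prod>j\<in>UNIV. integral {0..2 * pi} (\<lambda>t. exp (\<i> * of_real (t * of_int (w $ j)))))"
    unfolding angle_box_def eq
    by (subst integral_cbox_prod[where g = "\<lambda>b t. exp (\<i> * of_real (t * (of_N w \<bullet> b)))"])
      (auto intro!: continuous_intros simp: basis inner_axis of_N_def)
  also have "\<dots> = (\<Prod>j\<in>UNIV. if w $ j = 0 then 2 * of_real pi else 0)"
    by (simp only: integral_character_circle)
  also have "\<dots> = (if w = 0 then (2 * of_real pi) ^ CARD('n) else 0)"
    by (auto simp: vec_eq_iff prod_zero_iff)
  finally show ?thesis .
qed

text \<open>Absolute summability of the coefficients makes the series converge uniformly in the
  angles, so it may be integrated termwise; orthogonality of characters leaves the term u =
  w.\<close>

lemma fourier_coefficient: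
  fixes c :: "int^'n \<Rightarrow> complex"
  assumes summable: "(\<lambda>u. norm (c u)) summable_on UNIV"
    and F: "\<And>y. ((\<lambda>u. c u * exp (- \<i> * of_real (y \<bullet> of_N u))) has_sum F y) UNIV"
  shows "((\<lambda>y. F y * exp (\<i> * of_real (y \<bullet> of_N w))) has_integral (2 * of_real pi) ^ CARD('n) * c w) angle_box"
proof -
  let ?e = "\<lambda>w y. exp (\<i> * of_real (y \<bullet> of_N w))"
  let ?f = "\<lambda>u y. c u * exp (- \<i> * of_real (y \<bullet> of_N u)) * ?e w y"
  have f: "?f u y = c u * ?e (w - u) y" for u y
  proof -
    have "of_N w = of_N u + of_N (w - u)" by (simp flip: of_N_add)
    then show ?thesis by (simp add: inner_add_right algebra_simps flip: exp_add)
  qed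
  have int_f: "integral angle_box (?f u) = (if u = w then (2 * of_real pi) ^ CARD('n) * c w else 0)" for u
    unfolding f by (auto simp: integral_character)
  have cont: "continuous_on angle_box (?f u)" for u
    by (intro continuous_intros)
  have "uniform_limit angle_box (\<lambda>X y. \<Sum>u\<in>X. ?f u y) (\<lambda>y. F y * ?e w y) (finite_subsets_at_top UNIV)"
  proof (rule Weierstrass_m_test_general'[OF _ _ summable])
    show "norm (?f u y) \<le> norm (c u)" for u y by (simp add: norm_mult)
    show "((\<lambda>u. ?f u y) has_sum F y * ?e w y) UNIV" for y by (rule has_sum_cmult_left[OF F])
  qed
  then obtain I J where I: "\<And>X. ((\<lambda>y. \<Sum>u\<in>X. ?f u y) has_integral I X) angle_box"
    and J: "((\<lambda>y. F y * ?e w y) has_integral J) angle_box"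
    and lim: "(I \<longlongrightarrow> J) (finite_subsets_at_top UNIV)"
    unfolding angle_box_def
    using cont[unfolded angle_box_def]
    by (elim uniform_limit_integral_cbox) (auto intro!: continuous_on_sum)
  \<comment> \<open>Along the net of finite sets the integrals of the partial sums are constant once
    \<open>w\<close> belongs to the set, which identifies the limit \<open>J\<close>.\<close>
  have "I X = (2 * of_real pi) ^ CARD('n) * c w" if "finite X" "w \<in> X" for X
  proof -
    have "I X = integral angle_box (\<lambda>y. \<Sum>u\<in>X. ?f u y)"
      by (rule integral_unique[OF I[of X], symmetric])
    also have "\<dots> = (\<Sum>u\<in>X. integral angle_box (?f u))"
      using cont \<open>finite X\<close> unfolding angle_box_def by (intro integral_sum integrable_continuous)
    also have "\<dots> = (2 * of_real pi) ^ CARD('n) * c w"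
      using that by (simp only: int_f sum.delta if_True)
    finally show ?thesis .
  qed
  then have "eventually (\<lambda>X. I X = (2 * of_real pi) ^ CARD('n) * c w) (finite_subsets_at_top UNIV)"
    unfolding eventually_finite_subsets_at_top by (intro exI[of _ "{w}"]) auto
  then have "J = (2 * of_real pi) ^ CARD('n) * c w"
    using tendsto_unique[OF _ lim tendsto_eventually] by simp
  then show ?thesis using J by simp
qed

lemma exp_superpotential_fourier_coefficient:
  fixes v :: "'n + 'l::finite \<Rightarrow> int^'n"
  shows "((\<lambda>y. exp (superpotential v q (Y_point x y)) * exp (\<i> * of_real (y \<bullet> of_N w))) has_integral
    (2 * of_real pi) ^ CARD('n) * (of_real (Phi_coeff v q w) * of_real (exp (- (x \<bullet> of_N w))))) angle_box"
proof (rule fourier_coefficient)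
  \<comment> \<open>At angle 0 the norms of the terms are those of the Fourier coefficients on the
    torus over \<open>x\<close>, so summability there gives the required absolute bound.\<close>
  have "(\<lambda>w. of_real (Phi_coeff v q w) * zpow (Y_point x 0) w) summable_on UNIV"
    using exp_superpotential_lattice_series[of "Y_point x 0"] by (auto intro: has_sum_imp_summable)
  then have "(\<lambda>w. norm (of_real (Phi_coeff v q w) * zpow (Y_point x 0) w)) summable_on UNIV"
    by (simp only: summable_on_iff_abs_summable_on_complex)
  then show "(\<lambda>u. norm (complex_of_real (Phi_coeff v q u) * of_real (exp (- (x \<bullet> of_N u))))) summable_on UNIV"
    by (simp add: norm_mult cmod_zpow)
  show "((\<lambda>u. complex_of_real (Phi_coeff v q u) * of_real (exp (- (x \<bullet> of_N u))) *
      exp (- \<i> * of_real (y \<bullet> of_N u))) has_sum exp (superpotential v q (Y_point x y))) UNIV" for y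
    using exp_superpotential_lattice_series[of "Y_point x y" v q]
    by (simp add: zpow_Y_point exp_diff exp_minus exp_of_real divide_inverse mult_ac)
qed

section \<open>The transformations\<close>

definition complex_derivative_at :: "(complex^'n \<Rightarrow> complex) \<Rightarrow> complex^'n \<Rightarrow> bool" where
  "complex_derivative_at f z \<longleftrightarrow> (\<exists>D. (f has_derivative D) (at z) \<and> (\<forall>c h. D (c *s h) = c * D h))"

lemma complex_derivative_at_const: "complex_derivative_at (\<lambda>_. a) z"
  unfolding complex_derivative_at_def by (intro exI[of _ "\<lambda>_. 0"]) simp

lemma complex_derivative_at_coordinate: "complex_derivative_at (\<lambda>z. z $ j) z"
  unfolding complex_derivative_at_def
  by (intro exI[of _ "\<lambda>h. h $ j"]) (simp add: bounded_linear_imp_has_derivative bounded_linear_vec_nth)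

lemma complex_derivative_at_compose:
  assumes "complex_derivative_at f z" "(g has_field_derivative g') (at (f z))"
  shows "complex_derivative_at (\<lambda>z. g (f z)) z"
proof -
  obtain D where D: "(f has_derivative D) (at z)" "\<And>c h. D (c *s h) = c * D h"
    using assms(1) unfolding complex_derivative_at_def by blast
  have "((\<lambda>z. g (f z)) has_derivative (\<lambda>h. g' * D h)) (at z)"
    by (rule has_derivative_compose[OF D(1) has_field_derivative_imp_has_derivative[OF assms(2)]])
  then show ?thesis
    unfolding complex_derivative_at_def by (intro exI[of _ "\<lambda>h. g' * D h"]) (simp add: D(2))
qed

lemma complex_derivative_at_mult:
  assumes "complex_derivative_at f z" "complex_derivative_at g z"
  shows "complex_derivative_at (\<lambda>z. f z * g z) z"
proof -
  obtain D E where D: "(f has_derivative D) (at z)" "\<And>c h. D (c *s h) = c * D h"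
    and E: "(g has_derivative E) (at z)" "\<And>c h. E (c *s h) = c * E h"
    using assms unfolding complex_derivative_at_def by blast
  show ?thesis
    unfolding complex_derivative_at_def
    by (rule exI, rule conjI, rule has_derivative_mult[OF D(1) E(1)]) (simp add: D(2) E(2) algebra_simps)
qed

lemma complex_derivative_at_add:
  assumes "complex_derivative_at f z" "complex_derivative_at g z"
  shows "complex_derivative_at (\<lambda>z. f z + g z) z"
proof -
  obtain D E where D: "(f has_derivative D) (at z)" "\<And>c h. D (c *s h) = c * D h"
    and E: "(g has_derivative E) (at z)" "\<And>c h. E (c *s h) = c * E h"
    using assms unfolding complex_derivative_at_def by blast
  show ?thesis
    unfolding complex_derivative_at_def
    by (rule exI, rule conjI, rule has_derivative_add[OF D(1) E(1)]) (simp add: D(2) E(2) algebra_simps)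
qed

lemma complex_derivative_at_sum:
  "finite A \<Longrightarrow> (\<And>i. i \<in> A \<Longrightarrow> complex_derivative_at (f i) z) \<Longrightarrow>
    complex_derivative_at (\<lambda>z. \<Sum>i\<in>A. f i z) z"
  by (induction A rule: finite_induct)
    (simp_all add: complex_derivative_at_const complex_derivative_at_add)

lemma complex_derivative_at_prod:
  "finite A \<Longrightarrow> (\<And>i. i \<in> A \<Longrightarrow> complex_derivative_at (f i) z) \<Longrightarrow>
    complex_derivative_at (\<lambda>z. \<Prod>i\<in>A. f i z) z"
  by (induction A rule: finite_induct)
    (simp_all add: complex_derivative_at_const complex_derivative_at_mult)

lemma complex_derivative_at_exp_superpotential:
  fixes v :: "'n + 'l::finite \<Rightarrow> int^'n"
  assumes "\<And>j. z $ j \<noteq> 0"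
  shows "complex_derivative_at (\<lambda>z. exp (superpotential v q z)) z"
proof -
  have "complex_derivative_at (\<lambda>z. (z $ j) powi m) z" for j m
  proof (rule complex_derivative_at_compose[OF complex_derivative_at_coordinate])
    show "((\<lambda>x. x powi m) has_field_derivative of_int m * (z $ j) powi (m - 1)) (at (z $ j))"
      using has_derivative_power_int'[OF assms, where S = UNIV]
      by (simp add: has_field_derivative_def mult_commute_abs)
  qed
  then have "complex_derivative_at (superpotential v q) z"
    unfolding superpotential_def zpow_def
    by (intro complex_derivative_at_sum complex_derivative_at_mult complex_derivative_at_const
        complex_derivative_at_prod) simp_all
  then show ?thesis
    by (rule complex_derivative_at_compose) (rule DERIV_exp)
qed

lemma mirror_Y_nonzero: "z \<in> mirror_Y v q \<Longrightarrow> z $ j \<noteq> 0"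
  unfolding mirror_Y_def by auto

lemma nu_proj_mirror_Y: "z \<in> mirror_Y v q \<Longrightarrow> nu_proj z \<in> Pint v q"
  unfolding mirror_Y_def by auto

text \<open>The series sums to e^W on the open set of points with nonzero coordinates, a
  neighbourhood of every point of Y, so the derivative of e^W carries over.\<close>

lemma holomorphic_lattice_series:
  fixes v :: "'n + 'l::finite \<Rightarrow> int^'n"
  shows "holomorphic_on_Cn (\<lambda>z. \<Sum>\<^sub>\<infinity>w. of_real (Phi_coeff v q w) * zpow z w) (mirror_Y v q)"
  unfolding holomorphic_on_Cn_def
proof
  fix z assume "z \<in> mirror_Y v q"
  then have nz: "z $ j \<noteq> 0" for j by (rule mirror_Y_nonzero)
  obtain D where D: "((\<lambda>z. exp (superpotential v q z)) has_derivative D) (at z)"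
    "\<And>c h. D (c *s h) = c * D h"
    using complex_derivative_at_exp_superpotential[OF nz] unfolding complex_derivative_at_def by blast
  have "open (\<Inter>j\<in>UNIV. {z :: complex^'n. z $ j \<noteq> 0})"
    by (intro open_INT ballI open_Collect_neq continuous_intros) auto
  then have "((\<lambda>z. \<Sum>\<^sub>\<infinity>w. of_real (Phi_coeff v q w) * zpow z w) has_derivative D) (at z)"
    by (rule has_derivative_transform_within_open[OF D(1)])
      (use nz in \<open>auto simp: infsumI[OF exp_superpotential_lattice_series]\<close>)
  with D(2) show "\<exists>D. ((\<lambda>z. \<Sum>\<^sub>\<infinity>w. of_real (Phi_coeff v q w) * zpow z w) has_derivative D) (at z) \<and>
      (\<forall>c h. D (c *s h) = c * D h)"
    by blast
qed

section \<open>The transformations on functions\<close>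

lemma is_fibre_coeffs_Phi:
  fixes v :: "'n + 'l::finite \<Rightarrow> int^'n"
  shows "is_fibre_coeffs v q (Phi v q) (\<lambda>w. of_real (Phi_coeff v q w))"
  unfolding is_fibre_coeffs_def by (simp add: Phi_eq)

text \<open>This gives the \<open>THE\<close> in \<open>SYZ_fun\<close> its meaning. Over a point of
  P the fibre equation can be solved for the coefficient, because the exponential factor is
  nonzero.\<close>

lemma is_fibre_coeffs_unique:
  assumes "x \<in> Pint v q" "is_fibre_coeffs v q f c" "is_fibre_coeffs v q f d"
  shows "c = d"
proof
  fix w
  have "(x, torus_point 0) \<in> torus_orbit v q"
    using assms(1) by (simp add: torus_orbit_def)
  then show "c w = d w"
    using assms(2,3) unfolding is_fibre_coeffs_def by (metis exp_not_eq_zero mult_right_cancel of_real_eq_0_iff)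
qed

lemma admissible_Phi:
  fixes v :: "'n + 'l::finite \<Rightarrow> int^'n"
  shows "admissible v q (Phi v q)"
  unfolding admissible_def
proof (intro exI[of _ "\<lambda>w. of_real (Phi_coeff v q w)"] conjI ballI is_fibre_coeffs_Phi
    holomorphic_lattice_series)
  show "(\<lambda>w. of_real (Phi_coeff v q w) * zpow z w) summable_on UNIV" if "z \<in> mirror_Y v q" for z
    by (rule has_sum_imp_summable[OF exp_superpotential_lattice_series[OF mirror_Y_nonzero[OF that]]])
qed

lemma SYZ_fun_Phi:
  fixes v :: "'n + 'l::finite \<Rightarrow> int^'n"
  assumes z: "z \<in> mirror_Y v q"
  shows "SYZ_fun v q (Phi v q) z = exp (superpotential v q z)"
proof -
  \<comment> \<open>The projection of \<open>z\<close> is a point of P, which uniqueness of the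
    coefficients requires.\<close>
  have "(THE c. is_fibre_coeffs v q (Phi v q) c) = (\<lambda>w. of_real (Phi_coeff v q w))"
    by (intro the_equality is_fibre_coeffs_Phi)
      (rule is_fibre_coeffs_unique[OF nu_proj_mirror_Y[OF z] _ is_fibre_coeffs_Phi])
  then show ?thesis
    using infsumI[OF exp_superpotential_lattice_series, OF mirror_Y_nonzero[OF z]] by (simp add: SYZ_fun_def)
qed

lemma SYZ_inv_fun_exp_superpotential:
  fixes v :: "'n + 'l::finite \<Rightarrow> int^'n"
  shows "SYZ_inv_fun (\<lambda>z. exp (superpotential v q z)) (p, w) = Phi v q (p, w)"
  using integral_unique[OF exp_superpotential_fourier_coefficient[of v q "moment_map (p, w)" w]]
  by (simp add: SYZ_inv_fun_def Phi_eq)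

section \<open>The transformations on forms\<close>

lemma bounded_linear_smult_left: "bounded_linear (\<lambda>c. c *s a)"
  for a :: "complex ^ 'm"
  unfolding linear_conv_bounded_linear[symmetric]
  by (rule linearI) (simp_all add: vec_eq_iff algebra_simps)

lemma integral_angle_box_const:
  "integral angle_box (\<lambda>_ :: real^'n. a) = of_real ((2 * pi) ^ CARD('n)) *s a" for a :: "complex ^ 'm"
proof -
  have "cbox 0 (\<chi> j. 2 * pi) \<noteq> ({} :: (real^'n) set)"
    by (simp add: interval_ne_empty_cart)
  then show ?thesis
    unfolding angle_box_def integral_const scaleR_eq_smult by (subst content_cbox_cart) simp_all
qed

text \<open>Separates the volume (2 pi)^n of the torus from the power of -i that the top
  coefficients produce.\<close>

lemma minus_2_pi_i_power:
  "(- 2 * of_real pi * \<i>) ^ m = of_real ((2 * pi) ^ m) * (- \<i>) ^ m"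
proof -
  have "- 2 * of_real pi * \<i> = of_real (2 * pi) * (- \<i>)"
    by simp
  then show ?thesis
    by (simp only: power_mult_distrib[of "of_real (2 * pi)" "- \<i>"] of_real_power)
qed

text \<open>The radial factor e^(- <x, w>) of \<open>Phi\<close> and the holonomy e^(- i <y, w>)
  combine into z^w; the integrand is thus constant along T_N.\<close>

lemma SYZ_integrand_Phi:
  fixes v :: "'n::{finite,linorder} + 'l::finite \<Rightarrow> (int, 'n) vec"
  assumes z: "z \<in> mirror_Y v q"
  shows "SYZ_integrand (\<lambda>\<xi>. Phi v q \<xi> *s a) ((nu_proj z, t), w) z =
    (of_real (Phi_coeff v q w) * zpow z w) *s (a \<and>\<^sub>E ext_exp (\<i> *s curv_F))"
proof -
  obtain x y where "z = Y_point x y"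
    using z unfolding mirror_Y_def by blast
  then show ?thesis
    by (simp add: SYZ_integrand_def Phi_eq hol_Y_point zpow_Y_point moment_map_def wedge_scale_left
        vector_smult_assoc exp_diff exp_minus exp_of_real divide_inverse mult_ac)
qed

text \<open>The volume contributes (2 pi)^n and the top coefficient (-i)^n; together they match the
  normalising constant of \<open>SYZ\<close>.\<close>

lemma TN_integral_SYZ_integrand_Phi:
  fixes v :: "'n::{finite,linorder} + 'l::finite \<Rightarrow> (int, 'n) vec"
  assumes z: "z \<in> mirror_Y v q"
  shows "TN_integral (\<lambda>u. SYZ_integrand (\<lambda>\<xi>. Phi v q \<xi> *s ext_exp (\<i> *s omega_X))
      ((nu_proj z, torus_point u), w) z) =
    (of_real (Phi_coeff v q w) * zpow z w) *s ((- 2 * of_real pi * \<i>) ^ CARD('n) *s Omega_Y)"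
proof -
  \<comment> \<open>The orientation sign in \<open>TN_integral\<close> meets the equal sign from
    reordering the wedge product.\<close>
  have sign: "(-1) ^ m * (-1) ^ m = (1 :: complex)" for m
    by (simp flip: power_add)
  show ?thesis
    unfolding SYZ_integrand_Phi[OF z] TN_integral_def integral_angle_box_const top_coeff_scale
      top_coeff_exp_omega_X_curv_F vector_smult_assoc minus_2_pi_i_power
    by (simp only: mult_ac sign mult_1_left)
qed

text \<open>The scalar series for e^W is carried over by the bounded linear map that multiplies a
  fixed form; \<open>has_sum\<close> yields convergence as well as the value.\<close>

lemma SYZ_Phi:
  fixes v :: "'n::{finite,linorder} + 'l::finite \<Rightarrow> (int, 'n) vec"
  assumes z: "z \<in> mirror_Y v q"
  defines "\<alpha> \<equiv> \<lambda>\<xi>. Phi v q \<xi> *s ext_exp (\<i> *s omega_X)"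
  shows "((\<lambda>w. TN_integral (\<lambda>u. SYZ_integrand \<alpha> ((nu_proj z, torus_point u), w) z)) has_sum
      exp (superpotential v q z) *s ((- 2 * of_real pi * \<i>) ^ CARD('n) *s Omega_Y)) UNIV"
    and "SYZ \<alpha> z = exp (superpotential v q z) *s Omega_Y"
proof -
  show sum: "((\<lambda>w. TN_integral (\<lambda>u. SYZ_integrand \<alpha> ((nu_proj z, torus_point u), w) z)) has_sum
      exp (superpotential v q z) *s ((- 2 * of_real pi * \<i>) ^ CARD('n) *s Omega_Y)) UNIV"
    unfolding \<alpha>_def TN_integral_SYZ_integrand_Phi[OF z]
    by (intro has_sum_bounded_linear[OF bounded_linear_smult_left] exp_superpotential_lattice_series
        mirror_Y_nonzero[OF z])
  show "SYZ \<alpha> z = exp (superpotential v q z) *s Omega_Y"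
    unfolding SYZ_def infsumI[OF sum] vector_smult_assoc by simp
qed

text \<open>The form part is constant in the angles, so the integral is the scalar Fourier integral
  times a fixed form.\<close>

lemma SYZ_inv_integrand_exp_superpotential:
  fixes v :: "'n::{finite,linorder} + 'l::finite \<Rightarrow> (int, 'n) vec"
  shows "((\<lambda>y. SYZ_inv_integrand (\<lambda>z. exp (superpotential v q z) *s a) (p, w) (Y_point (moment_map (p, w)) y))
    has_integral ((2 * of_real pi) ^ CARD('n) * Phi v q (p, w)) *s (a \<and>\<^sub>E ext_exp (- (\<i> *s curv_F)))) angle_box"
proof -
  have "SYZ_inv_integrand (\<lambda>z. exp (superpotential v q z) *s a) (p, w) (Y_point (moment_map (p, w)) y) =
    (exp (superpotential v q (Y_point (moment_map (p, w)) y)) * exp (\<i> * of_real (y \<bullet> of_N w))) *s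
      (a \<and>\<^sub>E ext_exp (- (\<i> *s curv_F)))" for y
    by (simp add: SYZ_inv_integrand_def hol_Y_point exp_minus wedge_scale_left vector_smult_assoc mult.commute)
  then show ?thesis
    using has_integral_linear[OF exp_superpotential_fourier_coefficient[of v q "moment_map (p, w)" w]
        bounded_linear_smult_left[of "a \<and>\<^sub>E ext_exp (- (\<i> *s curv_F))"]]
    by (simp add: o_def Phi_eq)
qed

text \<open>The factors (2 pi)^n from the Fourier integral and (-i)^n from the top coefficient
  cancel the normalising constant.\<close>

lemma SYZ_inv_exp_superpotential:
  fixes v :: "'n::{finite,linorder} + 'l::finite \<Rightarrow> (int, 'n) vec"
  shows "SYZ_inv (\<lambda>z. exp (superpotential v q z) *s Omega_Y) (p, w) = Phi v q (p, w) *s ext_exp (\<i> *s omega_X)"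
proof -
  have "(2 * of_real pi) ^ CARD('n) * (- \<i>) ^ CARD('n) \<noteq> 0"
    by simp
  then have "1 / (- 2 * of_real pi * \<i>) ^ CARD('n) *
      ((2 * of_real pi) ^ CARD('n) * Phi v q (p, w) * (- \<i>) ^ CARD('n)) = Phi v q (p, w)"
    unfolding minus_2_pi_i_power by simp
  then show ?thesis
    unfolding SYZ_inv_def TM_integral_def integral_unique[OF SYZ_inv_integrand_exp_superpotential]
      top_coeff_scale top_coeff_Omega_Y_exp_curv_F vector_smult_assoc
    by (simp only: mult.assoc)
qed

theorem theorem3p2:
  fixes S :: "(real, 'n::{finite,linorder}) vec set set"
    and v :: "'n + 'l::finite \<Rightarrow> (int, 'n) vec"
    and q :: "real ^ 'l"
  assumes fano: "toric_fano S v"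
    and standard_basis: "\<And>j. v (Inl j) = axis j 1"
    and q_pos: "\<And>a. q $ a > 0"
    and kaehler: "normal_fan (Pbar v q) = S"
  shows "(\<forall>\<xi>\<in>LX v q. Phi_term v q \<xi> summable_on Phi_classes v \<xi>)
    \<and> admissible v q (Phi v q)
    \<and> (\<forall>z\<in>mirror_Y v q. SYZ_fun v q (Phi v q) z = exp (superpotential v q z))
    \<and> (\<forall>\<xi>\<in>LX v q. SYZ_inv_fun (\<lambda>z. exp (superpotential v q z)) \<xi> = Phi v q \<xi>)
    \<and> SYZ_converges v q (\<lambda>\<xi>. Phi v q \<xi> *s ext_exp (\<i> *s omega_X))
    \<and> (\<forall>z\<in>mirror_Y v q. SYZ (\<lambda>\<xi>. Phi v q \<xi> *s ext_exp (\<i> *s omega_X)) z = exp (superpotential v q z) *s Omega_Y)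
    \<and> SYZ_inv_converges v q (\<lambda>z. exp (superpotential v q z) *s Omega_Y)
    \<and> (\<forall>\<xi>\<in>LX v q. SYZ_inv (\<lambda>z. exp (superpotential v q z) *s Omega_Y) \<xi> = Phi v q \<xi> *s ext_exp (\<i> *s omega_X))"
proof (intro conjI ballI)
  show "Phi_term v q \<xi> summable_on Phi_classes v \<xi>" for \<xi>
    by (rule Phi_term_summable)
  show "admissible v q (Phi v q)"
    by (rule admissible_Phi)
  show "SYZ_fun v q (Phi v q) z = exp (superpotential v q z)" if "z \<in> mirror_Y v q" for z
    using that by (rule SYZ_fun_Phi)
  show "SYZ_inv_fun (\<lambda>z. exp (superpotential v q z)) \<xi> = Phi v q \<xi>" for \<xi>
    by (cases \<xi>) (simp only: SYZ_inv_fun_exp_superpotential)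
  show "SYZ_converges v q (\<lambda>\<xi>. Phi v q \<xi> *s ext_exp (\<i> *s omega_X))"
    unfolding SYZ_converges_def
  proof (intro ballI conjI allI)
    fix z w assume z: "z \<in> mirror_Y v q"
    \<comment> \<open>The integrand does not depend on \<open>u\<close>, so it is integrable over
      the bounded box.\<close>
    show "(\<lambda>u. SYZ_integrand (\<lambda>\<xi>. Phi v q \<xi> *s ext_exp (\<i> *s omega_X))
        ((nu_proj z, torus_point u), w) z) integrable_on angle_box"
      unfolding SYZ_integrand_Phi[OF z] angle_box_def by (rule integrable_const)
    show "(\<lambda>w. TN_integral (\<lambda>u. SYZ_integrand (\<lambda>\<xi>. Phi v q \<xi> *s ext_exp (\<i> *s omega_X))
        ((nu_proj z, torus_point u), w) z)) summable_on UNIV"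
      by (rule has_sum_imp_summable[OF SYZ_Phi(1)[OF z]])
  qed
  show "SYZ (\<lambda>\<xi>. Phi v q \<xi> *s ext_exp (\<i> *s omega_X)) z = exp (superpotential v q z) *s Omega_Y"
    if "z \<in> mirror_Y v q" for z
    using that by (rule SYZ_Phi(2))
  show "SYZ_inv_converges v q (\<lambda>z. exp (superpotential v q z) *s Omega_Y)"
    unfolding SYZ_inv_converges_def
    using has_integral_integrable[OF SYZ_inv_integrand_exp_superpotential] by auto
  show "SYZ_inv (\<lambda>z. exp (superpotential v q z) *s Omega_Y) \<xi> = Phi v q \<xi> *s ext_exp (\<i> *s omega_X)" for \<xi>
    by (cases \<xi>) (simp only: SYZ_inv_exp_superpotential)
qed

end
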